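(* Let $m,n\in\mathbb N$ (positive integers), and suppose that $F$ is a square matrix, with rows and columns indexed by the same finite set, in which every entry is an integer power of $\zeta_m$. Then the Kronecker product $F\otimes F_n$ is principally non-singular (as a complex matrix) if both conditions below are satisfied: (i) The ideal $\langle 1-\zeta_n\rangle$ generated by $1-\zeta_n$ is prime in $\mathbb Z[\zeta_{mn}]$, and the characteristic of the quotient ring $\mathbb Z[\zeta_{mn}]/\langle 1-\zeta_n\rangle$ is either $0$ or at least $n$; (ii) $f(F)$ is principally non-singular in $\mathbb Z[\zeta_{mn}]/\langle 1-\zeta_n\rangle$, where $f$ is the canonical epimorphism from $\mathbb Z[\zeta_{mn}]$ to $\mathbb Z[\zeta_{mn}]/\langle 1-\zeta_n\rangle$, and $f(F)$ is the matrix obtained by applying $f$ to every entry of $F$.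
   Context: For a positive integer $n$, $\zeta_n=e^{2\pi i/n}$ and $\mathbb Z_n=\{0,1,\ldots,n-1\}$. The Fourier matrix $F_n$ is the $n\times n$ complex matrix with rows and columns indexed by $\mathbb Z_n$ and $(j,k)$-th entry $\zeta_n^{jk}$ (no normalizing factor). If $F$ has rows and columns indexed by a finite set $G$, the Kronecker product $F\otimes F_n$ is the block matrix whose $(i,j)$-th block is $F[i,j]F_n$. Its rows and columns are indexed by $G\times\mathbb Z_n$, and its entry in row $(i,i')$ and column $(j,j')$ is $F[i,j]\,\zeta_n^{i'j'}$. For a square matrix $A$ over a commutative ring whose rows and columns are indexed by the same finite set, a principal minor is the determinant of the submatrix $A[\mathcal I,\mathcal I]$ obtained by keeping the rows and the columns with indices in the same subset $\mathcal I$ of the index set. $A$ is principally non-singular if all its principal minors are non-zero in that ring. *)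

theory Defs
  imports
    Complex_Main
    "HOL-Combinatorics.Permutations"
    "HOL-Algebra.QuotRing"
    "HOL-Algebra.Generated_Rings"
    "HOL-Algebra.Algebraic_Closure_Type"
begin

text \<open>
  Matrices are functions of two arguments, always paired with an explicit finite set that indexes
  both rows and columns. Values outside that set are irrelevant. The submatrix \<open>A[S, S]\<close> is
  therefore \<open>A\<close> itself, paired with \<open>S\<close>.
\<close>

text \<open>
  The Leibniz formula, for a commutative ring in the sense of \<open>HOL-Algebra\<close>. The distribution's
  determinant needs a type-class ring, which is not available for a quotient that depends on term
  parameters. The empty determinant is \<open>\<one>\<^bsub>R\<^esub>\<close>.
\<close>
definition ring_det :: "('a, 'b) ring_scheme \<Rightarrow> 'i set \<Rightarrow> ('i \<Rightarrow> 'i \<Rightarrow> 'a) \<Rightarrow> 'a" where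
  "ring_det R S A =
     (\<Oplus>\<^bsub>R\<^esub>p\<in>{p. p permutes S}.
        if evenperm p then \<Otimes>\<^bsub>R\<^esub>i\<in>S. A i (p i) else \<ominus>\<^bsub>R\<^esub> (\<Otimes>\<^bsub>R\<^esub>i\<in>S. A i (p i)))"

definition principally_nonsingular ::
    "('a, 'b) ring_scheme \<Rightarrow> 'i set \<Rightarrow> ('i \<Rightarrow> 'i \<Rightarrow> 'a) \<Rightarrow> bool" where
  "principally_nonsingular R G A \<longleftrightarrow> (\<forall>S. S \<subseteq> G \<longrightarrow> ring_det R S A \<noteq> \<zero>\<^bsub>R\<^esub>)"

definition ring_characteristic :: "('a, 'b) ring_scheme \<Rightarrow> nat" where
  "ring_characteristic R =
     (if \<exists>k::nat. k > 0 \<and> [k] \<cdot>\<^bsub>R\<^esub> \<one>\<^bsub>R\<^esub> = \<zero>\<^bsub>R\<^esub>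
      then LEAST k::nat. k > 0 \<and> [k] \<cdot>\<^bsub>R\<^esub> \<one>\<^bsub>R\<^esub> = \<zero>\<^bsub>R\<^esub> else 0)"

abbreviation complex_ring :: "complex ring" where
  "complex_ring \<equiv> ring_of_type_algebra"

definition zeta :: "nat \<Rightarrow> complex" where
  "zeta n = exp (2 * of_real pi * \<i> / of_nat n)"

definition cyclotomic_ring :: "nat \<Rightarrow> complex ring" where
  "cyclotomic_ring N = complex_ring \<lparr>carrier := generate_ring complex_ring {zeta N}\<rparr>"

definition fourier_matrix :: "nat \<Rightarrow> nat \<Rightarrow> nat \<Rightarrow> complex" where
  "fourier_matrix n j k = zeta n ^ (j * k)"

definition kronecker ::
    "('i \<Rightarrow> 'i \<Rightarrow> complex) \<Rightarrow> ('j \<Rightarrow> 'j \<Rightarrow> complex) \<Rightarrow> 'i \<times> 'j \<Rightarrow> 'i \<times> 'j \<Rightarrow> complex" where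
  "kronecker A B r c = A (fst r) (fst c) * B (snd r) (snd c)"

text \<open>Over the complex numbers, \<^const>\<open>ring_det\<close> is the usual determinant.\<close>
lemma ring_det_complex:
  fixes A :: "'i \<Rightarrow> 'i \<Rightarrow> complex"
  assumes "finite S"
  shows "ring_det complex_ring S A = (\<Sum>p | p permutes S. of_int (sign p) * (\<Prod>i\<in>S. A i (p i)))"
proof -
  interpret C: field complex_ring
    by (rule field_from_type_algebra)
  have carr: "x \<in> carrier complex_ring" for x
    by (simp add: ring_of_type_algebra_def)
  have minus: "\<ominus>\<^bsub>complex_ring\<^esub> x = - x" for x
    by (rule C.minus_equality) (auto simp: ring_of_type_algebra_def)
  have fp: "finprod complex_ring f B = prod f B" if "finite B" for f and B :: "'i set"
    using that by induction (auto simp: C.finprod_insert carr, auto simp: ring_of_type_algebra_def)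
  have fs: "finsum complex_ring f B = sum f B" if "finite B" for f and B :: "('i \<Rightarrow> 'i) set"
    using that by induction (auto simp: C.finsum_insert carr, auto simp: ring_of_type_algebra_def)
  show ?thesis
    unfolding ring_det_def
    by (subst fs) (auto simp: fp minus finite_permutations assms sign_def intro!: sum.cong)
qed

lemma cring_cyclotomic_ring: "cring (cyclotomic_ring N)"
proof -
  interpret C: field complex_ring
    by (rule field_from_type_algebra)
  have "ring (cyclotomic_ring N)"
    unfolding cyclotomic_ring_def
    by (rule C.generate_ring_is_ring) (simp add: ring_of_type_algebra_def)
  moreover have "comm_monoid (cyclotomic_ring N)"
    using ring.is_monoid[OF calculation]
    by (rule monoid.monoid_comm_monoidI) (simp add: cyclotomic_ring_def ring_of_type_algebra_def)
  ultimately show ?thesis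
    by (rule cring.intro)
qed

end

theory Submission
  imports
    Defs
    "Jordan_Normal_Form.Determinant"
begin

text \<open>
  Write \<open>\<pi> = 1 - \<zeta>\<^sub>n\<close> and localise \<open>\<int>[\<zeta>\<^sub>m\<^sub>n]\<close> at the prime ideal \<open>\<langle>\<pi>\<rangle>\<close>, so that the numbers
  \<open>1, \<dots>, n - 1\<close> become units. Let \<open>S\<close> index a minor and let \<open>S\<^sub>g\<close> be its fibre over \<open>g \<in> G\<close>. Expanding
  \<open>\<zeta>\<^sub>n\<^sup>a\<^sup>b = (1 - \<pi>)\<^sup>a\<^sup>b\<close> by the binomial theorem and rewriting it in the Newton bases of the nodes
  \<open>S\<^sub>g\<close> (in \<open>a\<close>) and \<open>S\<^sub>h\<close> (in \<open>b\<close>), the coefficient of \<open>N\<^sub>i(a) N\<^sub>j(b)\<close> is divisible by \<open>\<pi>\<close> to the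
  power \<open>max i j\<close>, and for \<open>i = j\<close> it is \<open>(- \<pi>)\<^sup>i / i!\<close> up to higher order. Hence the submatrix is
  \<open>A B A\<^sup>T\<close> with \<open>A\<close> triangular and invertible. After extracting \<open>\<pi>\<^sup>i\<close> from the rows \<open>(g, i)\<close>
  of \<open>B\<close>, what is left is block triangular modulo \<open>\<pi>\<close>, and its diagonal blocks are unit multiples of
  the principal submatrices of \<open>F\<close> on \<open>{g. i < |S\<^sub>g|}\<close>, whose determinants do not vanish modulo \<open>\<pi>\<close>.
\<close>

section \<open>Determinants over arbitrary finite index sets\<close>

text \<open>The formula of \<open>ring_det_complex\<close>, stated over a type class so that the
  product and transposition rules can be imported from matrices. Arbitrary index sets are kept
  because minors and level sets are not intervals.\<close>

definition leibniz_det :: "'i set \<Rightarrow> ('i \<Rightarrow> 'i \<Rightarrow> 'a) \<Rightarrow> 'a::comm_ring_1" where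
  "leibniz_det S A = (\<Sum>p | p permutes S. of_int (sign p) * (\<Prod>i\<in>S. A i (p i)))"

lemma leibniz_det_cong:
  assumes "\<And>i j. i \<in> S \<Longrightarrow> j \<in> S \<Longrightarrow> A i j = B i j"
  shows "leibniz_det S A = leibniz_det S B"
  unfolding leibniz_det_def
  by (intro sum.cong refl arg_cong2[of _ _ _ _ "(*)"] prod.cong assms)
     (auto simp: permutes_in_image)

text \<open>Conjugation by \<open>f\<close> carries the permutations of \<open>T\<close> to those of
  \<open>S\<close> and preserves signs. It serves both to enumerate an index set by natural numbers
  and to rename the rows of a minor.\<close>

lemma leibniz_det_reindex:
  fixes A :: "'i \<Rightarrow> 'i \<Rightarrow> 'a::comm_ring_1"
  assumes "bij_betw f T S" and "finite T"
  shows "leibniz_det S A = leibniz_det T (\<lambda>i j. A (f i) (f j))"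
proof -
  have inj: "inj_on f T" and im: "f ` T = S"
    using assms by (auto simp: bij_betw_def)
  have "(\<lambda>p x. if x \<in> S then f (p (inv_into T f x)) else x) = map_permutation T f"
    by (auto simp: fun_eq_iff map_permutation_def restrict_id_def im)
  then have bij: "bij_betw (map_permutation T f) {p. p permutes T} {p. p permutes S}"
    using bij_betw_permutations[OF assms(1)] by simp
  have "leibniz_det S A = (\<Sum>p | p permutes T. of_int (sign (map_permutation T f p)) *
      (\<Prod>i\<in>S. A i (map_permutation T f p i)))"
    unfolding leibniz_det_def
    by (rule sum.reindex_bij_betw[OF bij, symmetric])
  also have "\<dots> = leibniz_det T (\<lambda>i j. A (f i) (f j))"
    unfolding leibniz_det_def
  proof (intro sum.cong refl arg_cong2[of _ _ _ _ "(*)"])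
    fix p assume "p \<in> {p. p permutes T}"
    then have p: "p permutes T" by simp
    show "of_int (sign (map_permutation T f p)) = (of_int (sign p) :: 'a)"
      by (subst sign_map_permutation[OF inj p assms(2)]) (rule refl)
    show "(\<Prod>i\<in>S. A i (map_permutation T f p i)) = (\<Prod>i\<in>T. A (f i) (f (p i)))"
      unfolding im[symmetric]
      by (simp add: prod.reindex[OF inj] map_permutation_apply[OF inj])
  qed
  finally show ?thesis .
qed

lemma leibniz_det_scale_rows:
  "leibniz_det S (\<lambda>i j. c i * A i j) = (\<Prod>i\<in>S. c i) * leibniz_det S A"
  unfolding leibniz_det_def
  by (simp add: prod.distrib sum_distrib_left mult_ac)

text \<open>If \<open>p\<close> contributes, every moved index satisfies
  \<open>l (p i) < l i\<close>. By induction on the level, \<open>p i\<close> is already fixed, so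
  injectivity forces \<open>p i = i\<close> and only the identity survives. The \<open>\<le>\<close>
  in \<open>tri\<close> makes entries between distinct indices of equal level vanish too.\<close>

lemma leibniz_det_triangular:
  fixes l :: "'i \<Rightarrow> nat"
  assumes "finite S"
    and tri: "\<And>i j. i \<in> S \<Longrightarrow> j \<in> S \<Longrightarrow> i \<noteq> j \<Longrightarrow> l i \<le> l j \<Longrightarrow> A i j = 0"
  shows "leibniz_det S A = (\<Prod>i\<in>S. A i i)"
proof -
  have zero: "(\<Prod>i\<in>S. A i (p i)) = 0" if p: "p permutes S" and "p \<noteq> id" for p
  proof (rule ccontr)
    assume "(\<Prod>i\<in>S. A i (p i)) \<noteq> 0"
    then have nz: "A i (p i) \<noteq> 0" if "i \<in> S" for i
      using that prod_zero[OF assms(1)] by metis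
    have "p i = i" if "i \<in> S" for i
      using that
    proof (induction "l i" arbitrary: i rule: less_induct)
      case less
      show ?case
      proof (rule ccontr)
        assume ne: "p i \<noteq> i"
        have S: "p i \<in> S" using less.prems p by (simp add: permutes_in_image)
        with tri[of i "p i"] nz[of i] less.prems ne have "l (p i) < l i"
          by (metis not_le)
        from less.hyps[OF this S] ne show False
          using permutes_inj[OF p] by (simp add: inj_eq)
      qed
    qed
    with p have "p = id"
      by (metis eq_id_iff permutes_not_in)
    with that show False by simp
  qed
  have "leibniz_det S A = (\<Sum>p\<in>{id}. of_int (sign p) * (\<Prod>i\<in>S. A i (p i)))"
    unfolding leibniz_det_def
    by (rule sum.mono_neutral_right)
       (use zero assms(1) in \<open>auto simp: finite_permutations permutes_id\<close>)
  then show ?thesis by simp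
qed

lemma leibniz_det_eq_det:
  "leibniz_det {0..<n} A = det (mat n n (\<lambda>(i, j). A i j))"
  unfolding leibniz_det_def det_def dim_row_mat dim_col_mat simp_thms if_True
  by (intro sum.cong refl arg_cong2[of _ _ _ _ "(*)"] prod.cong)
     (simp_all add: permutes_nat_less)

lemma leibniz_det_mult:
  assumes "finite S"
  shows "leibniz_det S (\<lambda>i k. \<Sum>j\<in>S. A i j * B j k) = leibniz_det S A * leibniz_det S B"
proof -
  obtain f where f: "bij_betw f {0..<card S} S"
    using ex_bij_betw_nat_finite[OF assms] by blast
  let ?n = "card S"
  let ?M = "\<lambda>A. mat ?n ?n (\<lambda>(i, j). A (f i) (f j))"
  have "mat ?n ?n (\<lambda>(i, k). \<Sum>j\<in>S. A (f i) j * B j (f k)) = ?M A * ?M B"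
    by (rule eq_matI)
       (auto simp: scalar_prod_def sum.reindex_bij_betw[OF f, symmetric])
  then show ?thesis
    by (simp add: leibniz_det_reindex[OF f] leibniz_det_eq_det det_mult[of _ ?n])
qed

lemma leibniz_det_transpose:
  assumes "finite S"
  shows "leibniz_det S (\<lambda>i j. A j i) = leibniz_det S A"
proof -
  obtain f where f: "bij_betw f {0..<card S} S"
    using ex_bij_betw_nat_finite[OF assms] by blast
  let ?n = "card S"
  let ?M = "mat ?n ?n (\<lambda>(i, j). A (f i) (f j))"
  have "mat ?n ?n (\<lambda>(i, j). A (f j) (f i)) = transpose_mat ?M"
    by (rule eq_matI) auto
  then show ?thesis
    by (simp add: leibniz_det_reindex[OF f] leibniz_det_eq_det det_transpose[of _ ?n])
qed

text \<open>A permutation that moves some index of \<open>S\<close> into \<open>T\<close> meets a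
  zero entry. The others stabilise \<open>S\<close> and \<open>T\<close>, hence factor uniquely as a
  permutation of \<open>S\<close> composed with one of \<open>T\<close>, and signs and products
  split accordingly.\<close>

lemma leibniz_det_block_Un:
  assumes fin: "finite S" "finite T" and disj: "S \<inter> T = {}"
    and zero: "\<And>i j. i \<in> S \<Longrightarrow> j \<in> T \<Longrightarrow> A i j = 0"
  shows "leibniz_det (S \<union> T) A = leibniz_det S A * leibniz_det T A"
proof -
  let ?t = "\<lambda>p. of_int (sign p) * (\<Prod>i\<in>S \<union> T. A i (p i))"
  let ?P = "{p. p permutes S \<union> T \<and> p ` S = S}"
  have "leibniz_det (S \<union> T) A = sum ?t ?P"
    unfolding leibniz_det_def
  proof (rule sum.mono_neutral_right)
    show "finite {p. p permutes S \<union> T}" using fin by (simp add: finite_permutations)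
    show "\<forall>p\<in>{p. p permutes S \<union> T} - ?P. ?t p = 0"
    proof
      fix p assume "p \<in> {p. p permutes S \<union> T} - ?P"
      then have p: "p permutes S \<union> T" and ne: "p ` S \<noteq> S" by auto
      \<comment> \<open>An injective map of the finite set \<open>S\<close> into itself would be
        onto.\<close>
      have "\<not> p ` S \<subseteq> S"
        using ne endo_inj_surj[OF fin(1)] permutes_inj_on[OF p] by blast
      then obtain i where "i \<in> S" "p i \<notin> S" by auto
      with p have "p i \<in> T" by (metis UnCI UnE permutes_in_image)
      with \<open>i \<in> S\<close> have "A i (p i) = 0" by (rule zero)
      with \<open>i \<in> S\<close> have "(\<Prod>i\<in>S \<union> T. A i (p i)) = 0"
        by (intro prod_zero) (use fin in auto)
      then show "?t p = 0" by simp
    qed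
  qed auto
  also have "\<dots> = (\<Sum>(p, q)\<in>{p. p permutes S} \<times> {q. q permutes T}. ?t (p \<circ> q))"
  proof (rule sum.reindex_bij_witness[where i = "\<lambda>(p, q). p \<circ> q" and
        j = "\<lambda>p. (restrict_id p S, restrict_id p T)"])
    fix p assume "p \<in> ?P"
    then have p: "p permutes S \<union> T" and S: "p ` S = S" by auto
    have T: "p ` T = T"
    proof -
      have T: "T = (S \<union> T) - S" using disj by blast
      have "p ` ((S \<union> T) - S) = p ` (S \<union> T) - p ` S"
        by (rule image_set_diff[OF permutes_inj[OF p]])
      also have "\<dots> = (S \<union> T) - S" by (simp only: permutes_image[OF p] S)
      finally show ?thesis using T by simp
    qed
    have inv: "restrict_id p S \<circ> restrict_id p T = p"
    proof
      fix x
      show "(restrict_id p S \<circ> restrict_id p T) x = p x"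
        using disj T permutes_not_in[OF p, of x] by (auto simp: restrict_id_def)
    qed
    show "(case (restrict_id p S, restrict_id p T) of (p, q) \<Rightarrow> p \<circ> q) = p"
      using inv by simp
    show "(restrict_id p S, restrict_id p T) \<in> {p. p permutes S} \<times> {q. q permutes T}"
      using S T permutes_inj_on[OF p] by (auto intro!: permutes_restrict_id simp: bij_betw_def)
    show "(case (restrict_id p S, restrict_id p T) of (p, q) \<Rightarrow> ?t (p \<circ> q)) = ?t p"
      by (simp only: prod.case inv)
  next
    fix pq assume "pq \<in> {p. p permutes S} \<times> {q. q permutes T}"
    then obtain p q where pq: "pq = (p, q)" and p: "p permutes S" and q: "q permutes T" by auto
    have pT: "p x = x" if "x \<in> T" for x using that disj permutes_not_in[OF p] by blast
    have qS: "q x = x" if "x \<in> S" for x using that disj permutes_not_in[OF q] by blast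
    have "p \<circ> q permutes S \<union> T"
      using p q by (intro permutes_compose) (auto intro: permutes_subset)
    moreover have "(p \<circ> q) ` S = S"
      using permutes_image[OF p] by (auto simp: qS image_iff set_eq_iff)
    ultimately show "(case pq of (p, q) \<Rightarrow> p \<circ> q) \<in> ?P" by (simp add: pq)
    have "restrict_id (p \<circ> q) S = p"
      by (rule ext) (auto simp: restrict_id_def qS permutes_not_in[OF p])
    moreover have "restrict_id (p \<circ> q) T = q"
      by (rule ext) (auto simp: restrict_id_def permutes_not_in[OF q] pT permutes_in_image[OF q])
    ultimately show "(restrict_id (case pq of (p, q) \<Rightarrow> p \<circ> q) S,
        restrict_id (case pq of (p, q) \<Rightarrow> p \<circ> q) T) = pq" by (simp add: pq)
  qed
  also have "\<dots> = (\<Sum>(p, q)\<in>{p. p permutes S} \<times> {q. q permutes T}.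
      (of_int (sign p) * (\<Prod>i\<in>S. A i (p i))) * (of_int (sign q) * (\<Prod>i\<in>T. A i (q i))))"
  proof (intro sum.cong refl, clarify)
    fix p q assume p: "p permutes S" and q: "q permutes T"
    have pT: "p x = x" if "x \<in> T" for x using that disj permutes_not_in[OF p] by blast
    have qS: "q x = x" if "x \<in> S" for x using that disj permutes_not_in[OF q] by blast
    have "(\<Prod>i\<in>S. A i ((p \<circ> q) i)) = (\<Prod>i\<in>S. A i (p i))"
      by (intro prod.cong) (auto simp: qS)
    moreover have "(\<Prod>i\<in>T. A i ((p \<circ> q) i)) = (\<Prod>i\<in>T. A i (q i))"
      by (intro prod.cong) (auto simp: pT permutes_in_image[OF q])
    moreover have "sign (p \<circ> q) = sign p * sign q"
      using p q fin by (intro sign_compose) (auto simp: permutes_imp_permutation)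
    ultimately show "?t (p \<circ> q) =
        (of_int (sign p) * (\<Prod>i\<in>S. A i (p i))) * (of_int (sign q) * (\<Prod>i\<in>T. A i (q i)))"
      using fin disj by (simp add: prod.union_disjoint mult_ac)
  qed
  also have "\<dots> = leibniz_det S A * leibniz_det T A"
    by (simp add: leibniz_det_def sum_product sum.cartesian_product)
  finally show ?thesis .
qed

text \<open>Peel off the highest level repeatedly: rows of lower level vanish in its columns, so the
  two-block case applies.\<close>

lemma leibniz_det_block_triangular:
  fixes l :: "'i \<Rightarrow> nat"
  assumes fin: "finite S" and lt: "\<And>i. i \<in> S \<Longrightarrow> l i < n"
    and zero: "\<And>i j. i \<in> S \<Longrightarrow> j \<in> S \<Longrightarrow> l i < l j \<Longrightarrow> A i j = 0"
  shows "leibniz_det S A = (\<Prod>k<n. leibniz_det {i \<in> S. l i = k} A)"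
proof -
  have "leibniz_det {i \<in> S. l i < n} A = (\<Prod>k<n. leibniz_det {i \<in> S. l i = k} A)" for n
  proof (induction n)
    case 0
    then show ?case by (simp add: leibniz_det_def)
  next
    case (Suc n)
    have "{i \<in> S. l i < Suc n} = {i \<in> S. l i < n} \<union> {i \<in> S. l i = n}" by auto
    moreover have "leibniz_det \<dots> A = leibniz_det {i \<in> S. l i < n} A * leibniz_det {i \<in> S. l i = n} A"
      by (rule leibniz_det_block_Un) (use fin zero in auto)
    ultimately show ?case using Suc by simp
  qed
  moreover have "{i \<in> S. l i < n} = S" using lt by auto
  ultimately show ?thesis by metis
qed

section \<open>Newton bases\<close>

definition newton_poly :: "(nat \<Rightarrow> 'a) \<Rightarrow> nat \<Rightarrow> 'a \<Rightarrow> 'a::comm_ring_1" where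
  "newton_poly a i x = (\<Prod>t<i. x - a t)"

text \<open>The recursion comes from \<open>x * N i = N (Suc i) + a i * N i\<close> for the Newton
  polynomials \<open>N\<close>. For \<open>i \<le> l\<close> the value is the complete homogeneous
  symmetric polynomial of degree \<open>l - i\<close> in \<open>a 0, ..., a i\<close>. No division
  occurs, so values stay in every subring containing the nodes.\<close>

primrec newton_coeff :: "(nat \<Rightarrow> 'a) \<Rightarrow> nat \<Rightarrow> nat \<Rightarrow> 'a::comm_ring_1" where
  "newton_coeff a 0 i = (if i = 0 then 1 else 0)"
| "newton_coeff a (Suc l) i =
     (if i = 0 then 0 else newton_coeff a l (i - 1)) + a i * newton_coeff a l i"

lemma newton_poly_node_eq_0: "i < j \<Longrightarrow> newton_poly a j (a i) = 0"
  unfolding newton_poly_def by (rule prod_zero) auto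

lemma newton_coeff_eq_0: "l < i \<Longrightarrow> newton_coeff a l i = 0"
  by (induction l arbitrary: i) auto

lemma newton_coeff_self [simp]: "newton_coeff a l l = 1"
  by (induction l) (auto simp: newton_coeff_eq_0)

lemma power_eq_sum_newton: "x ^ l = (\<Sum>i\<le>l. newton_coeff a l i * newton_poly a i x)"
proof (induction l)
  case 0
  then show ?case by (simp add: newton_poly_def)
next
  case (Suc l)
  let ?c = "newton_coeff a l" and ?N = "\<lambda>i. newton_poly a i x"
  have "(\<Sum>i\<le>Suc l. newton_coeff a (Suc l) i * ?N i) =
      (\<Sum>i\<le>Suc l. (if i = 0 then 0 else ?c (i - 1)) * ?N i) + (\<Sum>i\<le>Suc l. a i * ?c i * ?N i)"
    by (simp only: newton_coeff.simps distrib_right sum.distrib)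
  also have "(\<Sum>i\<le>Suc l. (if i = 0 then 0 else ?c (i - 1)) * ?N i) = (\<Sum>i\<le>l. ?c i * ?N (Suc i))"
    by (subst sum.atMost_Suc_shift) simp
  also have "(\<Sum>i\<le>Suc l. a i * ?c i * ?N i) = (\<Sum>i\<le>l. a i * ?c i * ?N i)"
    by (simp add: newton_coeff_eq_0)
  also have "(\<Sum>i\<le>l. ?c i * ?N (Suc i)) + (\<Sum>i\<le>l. a i * ?c i * ?N i) = x * (\<Sum>i\<le>l. ?c i * ?N i)"
    unfolding sum_distrib_left sum.distrib[symmetric]
    by (intro sum.cong) (auto simp: newton_poly_def algebra_simps)
  finally show ?case using Suc by simp
qed

text \<open>At a node with index below \<open>s\<close>, all Newton polynomials from index
  \<open>s\<close> on vanish. The length of the sum thus becomes independent of the exponent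
  \<open>l\<close>; the proof passes through a range long enough for both bounds.\<close>

lemma power_node_eq_sum_newton:
  assumes "i < s"
  shows "a i ^ l = (\<Sum>j<s. newton_coeff a l j * newton_poly a j (a i))"
proof -
  have "a i ^ l = (\<Sum>j<s + Suc l. newton_coeff a l j * newton_poly a j (a i))"
    unfolding power_eq_sum_newton[of "a i" l a]
    by (rule sum.mono_neutral_left) (auto simp: newton_coeff_eq_0)
  also have "\<dots> = (\<Sum>j<s. newton_coeff a l j * newton_poly a j (a i))"
    by (rule sum.mono_neutral_right) (use assms in \<open>auto simp: newton_poly_node_eq_0\<close>)
  finally show ?thesis .
qed

text \<open>The falling factorial \<open>x (x - 1) ... (x - k + 1)\<close>, whose coefficients are
  the signed Stirling numbers of the first kind. Taking it over the integers puts these coefficients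
  into every subring.\<close>

definition falling_poly :: "nat \<Rightarrow> int poly" where
  "falling_poly k = (\<Prod>t<k. [:- int t, 1:])"

lemma degree_falling_poly: "degree (falling_poly k) = k"
  unfolding falling_poly_def by (subst degree_prod_eq_sum_degree) auto

lemma coeff_falling_poly_self: "coeff (falling_poly k) k = 1"
  using lead_coeff_prod[of "\<lambda>t. [:- int t, 1:]" "{..<k}"]
  by (simp add: degree_falling_poly flip: falling_poly_def)

lemma binomial_eq_falling_poly:
  "(of_nat (u choose k) :: 'a::field_char_0) =
     (\<Sum>l\<le>k. of_int (coeff (falling_poly k) l) * of_nat u ^ l) / fact k"
proof -
  have "(\<Prod>i = 0..<k. of_nat u - of_nat i :: 'a) = of_int (poly (falling_poly k) (int u))"
    by (simp add: falling_poly_def poly_prod atLeast0LessThan)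
  also have "\<dots> = (\<Sum>l\<le>k. of_int (coeff (falling_poly k) l) * of_nat u ^ l)"
    by (simp add: poly_altdef degree_falling_poly)
  finally show ?thesis by (simp add: binomial_gbinomial gbinomial_prod_rev)
qed

section \<open>Minors modulo a prime element\<close>

text \<open>\<open>\<pi>\<close> stands for \<open>1 - \<zeta>\<^sub>n\<close>, which vanishes when \<open>n = 1\<close>.\<close>

locale prime_element =
  fixes R :: "'a::field_char_0 set" and \<pi> :: 'a and n :: nat
  assumes one_closed [simp]: "1 \<in> R"
    and add_closed: "\<And>x y. x \<in> R \<Longrightarrow> y \<in> R \<Longrightarrow> x + y \<in> R"
    and uminus_closed: "\<And>x. x \<in> R \<Longrightarrow> - x \<in> R"
    and mult_closed: "\<And>x y. x \<in> R \<Longrightarrow> y \<in> R \<Longrightarrow> x * y \<in> R"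
    and pi_closed [simp]: "\<pi> \<in> R"
    and pi_nz: "n > 1 \<Longrightarrow> \<pi> \<noteq> 0"
    and one_notin: "1 \<notin> (*) \<pi> ` R"
    and prime: "\<And>x y. x \<in> R \<Longrightarrow> y \<in> R \<Longrightarrow> x * y \<in> (*) \<pi> ` R \<Longrightarrow> x \<in> (*) \<pi> ` R \<or> y \<in> (*) \<pi> ` R"
    and inverse_of_nat: "\<And>k. 0 < k \<Longrightarrow> k < n \<Longrightarrow> inverse (of_nat k) \<in> R"
begin

section \<open>Closure properties of \<open>R\<close> and congruences modulo
  \<open>P\<close>\<close>

abbreviation "P \<equiv> (*) \<pi> ` R"

lemma diff_closed: "x \<in> R \<Longrightarrow> y \<in> R \<Longrightarrow> x - y \<in> R"
  using add_closed[OF _ uminus_closed, of x y] by simp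

lemma zero_closed [simp]: "0 \<in> R"
  using diff_closed[of 1 1] by simp

lemma sum_closed: "(\<And>x. x \<in> A \<Longrightarrow> f x \<in> R) \<Longrightarrow> sum f A \<in> R"
  by (induction A rule: infinite_finite_induct) (auto intro: add_closed)

lemma prod_closed: "(\<And>x. x \<in> A \<Longrightarrow> f x \<in> R) \<Longrightarrow> prod f A \<in> R"
  by (induction A rule: infinite_finite_induct) (auto intro: mult_closed)

lemma power_closed: "x \<in> R \<Longrightarrow> x ^ k \<in> R"
  by (induction k) (auto intro: mult_closed)

lemma of_nat_closed [simp]: "of_nat k \<in> R"
  by (induction k) (auto intro: add_closed)

lemma of_int_closed [simp]: "of_int k \<in> R"
  by (cases k rule: int_cases2) (auto intro: uminus_closed)

lemmas closed = add_closed uminus_closed mult_closed diff_closed sum_closed prod_closed power_closed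

lemma inverse_fact_closed: "k < n \<Longrightarrow> inverse (fact k) \<in> R"
proof (induction k)
  case (Suc k)
  then have "inverse (of_nat (Suc k)) * inverse (fact k) \<in> R"
    by (intro closed inverse_of_nat) auto
  then show ?case by (simp add: field_simps)
qed simp

lemma inverse_diff_closed:
  assumes "i < n" "j < n" "i \<noteq> j"
  shows "inverse (of_nat i - of_nat j) \<in> R"
proof (cases "i < j")
  case True
  then have "inverse (of_nat i - of_nat j :: 'a) = - inverse (of_nat (j - i))"
    by (simp add: of_nat_diff flip: inverse_minus_eq)
  moreover have "\<dots> \<in> R"
    using True assms by (intro uminus_closed inverse_of_nat) auto
  ultimately show ?thesis by metis
next
  case False
  then have "inverse (of_nat i - of_nat j :: 'a) = inverse (of_nat (i - j))"
    by (simp add: of_nat_diff)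
  moreover have "\<dots> \<in> R"
    using False assms by (intro inverse_of_nat) auto
  ultimately show ?thesis by metis
qed

lemma zero_in_P: "0 \<in> P"
  by (auto intro!: image_eqI[of _ _ 0])

lemma P_add: "x \<in> P \<Longrightarrow> y \<in> P \<Longrightarrow> x + y \<in> P"
  by (auto simp flip: distrib_left intro: closed)

lemma P_uminus: "x \<in> P \<Longrightarrow> - x \<in> P"
  by (auto simp flip: mult_minus_right intro: closed)

lemma P_mult: "x \<in> R \<Longrightarrow> y \<in> P \<Longrightarrow> x * y \<in> P"
  by (auto intro!: closed image_eqI[of "x * (\<pi> * z)" _ "x * z" for z])

lemma P_sum: "(\<And>x. x \<in> A \<Longrightarrow> f x \<in> P) \<Longrightarrow> sum f A \<in> P"
  by (induction A rule: infinite_finite_induct) (auto intro: P_add zero_in_P simp del: image_iff)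

lemma unit_notin_P: "x \<in> R \<Longrightarrow> x * y = 1 \<Longrightarrow> y \<notin> P"
  using P_mult one_notin by metis

lemma prod_notin_P:
  "finite A \<Longrightarrow> (\<And>x. x \<in> A \<Longrightarrow> f x \<in> R) \<Longrightarrow> (\<And>x. x \<in> A \<Longrightarrow> f x \<notin> P) \<Longrightarrow> prod f A \<notin> P"
proof (induction A rule: finite_induct)
  case empty
  then show ?case using one_notin by simp
next
  case (insert x A)
  then have "f x \<in> R" "prod f A \<in> R" "f x \<notin> P" "prod f A \<notin> P"
    by (auto intro!: closed simp del: image_iff)
  then show ?case using prime insert.hyps by (metis prod.insert)
qed

lemma prod_cong_mod_P:
  assumes "\<And>x. x \<in> A \<Longrightarrow> f x \<in> R" and "\<And>x. x \<in> A \<Longrightarrow> g x \<in> R"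
    and "\<And>x. x \<in> A \<Longrightarrow> f x - g x \<in> P"
  shows "prod f A - prod g A \<in> P"
  using assms
proof (induction A rule: infinite_finite_induct)
  case (insert x A)
  \<comment> \<open>Replace one factor at a time: the usual splitting of
    \<open>a b - c d\<close>.\<close>
  have "prod f (insert x A) - prod g (insert x A) =
      f x * (prod f A - prod g A) + prod g A * (f x - g x)"
    using insert.hyps by (simp add: algebra_simps)
  also have "\<dots> \<in> P"
    by (intro P_add P_mult insert closed) (use insert.prems in auto)
  finally show ?case .
qed (auto simp: zero_in_P simp del: image_iff)

lemma leibniz_det_closed:
  assumes "\<And>i j. i \<in> S \<Longrightarrow> j \<in> S \<Longrightarrow> A i j \<in> R"
  shows "leibniz_det S A \<in> R"
  unfolding leibniz_det_def
  by (intro closed of_int_closed assms) (auto simp: permutes_in_image)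

lemma leibniz_det_cong_mod_P:
  assumes "\<And>i j. i \<in> S \<Longrightarrow> j \<in> S \<Longrightarrow> A i j \<in> R"
    and "\<And>i j. i \<in> S \<Longrightarrow> j \<in> S \<Longrightarrow> B i j \<in> R"
    and "\<And>i j. i \<in> S \<Longrightarrow> j \<in> S \<Longrightarrow> A i j - B i j \<in> P"
  shows "leibniz_det S A - leibniz_det S B \<in> P"
  unfolding leibniz_det_def sum_subtractf[symmetric] right_diff_distrib[symmetric]
  by (intro P_sum P_mult of_int_closed prod_cong_mod_P assms) (auto simp: permutes_in_image)

section \<open>Newton interpolation with coefficients in \<open>R\<close>\<close>

lemma newton_coeff_closed: "(\<And>i. a i \<in> R) \<Longrightarrow> newton_coeff a l i \<in> R"
  by (induction l arbitrary: i) (auto intro: closed)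

lemma newton_poly_closed: "(\<And>i. a i \<in> R) \<Longrightarrow> x \<in> R \<Longrightarrow> newton_poly a i x \<in> R"
  unfolding newton_poly_def by (intro closed)

text \<open>Adding a node requires division only by the value of the new Newton polynomial at that
  node. This is a product of differences of distinct natural numbers below \<open>n\<close>, hence a
  unit of \<open>R\<close>.\<close>

lemma newton_interpolation:
  assumes "inj_on a {..<s}" and "\<And>i. i < s \<Longrightarrow> a i < n" and "\<And>i. i < s \<Longrightarrow> f i \<in> R"
  shows "\<exists>c. (\<forall>j. c j \<in> R) \<and>
    (\<forall>i<s. f i = (\<Sum>j<s. c j * newton_poly (\<lambda>t. of_nat (a t)) j (of_nat (a i))))"
  using assms
proof (induction s)
  case 0
  then show ?case by (auto intro!: exI[of _ "\<lambda>_. 0"])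
next
  case (Suc s)
  let ?N = "\<lambda>j i. newton_poly (\<lambda>t. of_nat (a t)) j (of_nat (a i) :: 'a)"
  have "\<exists>c. (\<forall>j. c j \<in> R) \<and> (\<forall>i<s. f i = (\<Sum>j<s. c j * ?N j i))"
    using Suc.prems by (intro Suc.IH) (auto intro: inj_on_subset)
  then obtain c where c: "\<And>j. c j \<in> R" "\<And>i. i < s \<Longrightarrow> f i = (\<Sum>j<s. c j * ?N j i)" by auto
  have ne: "a s \<noteq> a t" if "t < s" for t
    using inj_onD[OF Suc.prems(1), of s t] that by auto
  then have nz: "?N s s \<noteq> 0" by (simp add: newton_poly_def)
  have "inverse (?N s s) = (\<Prod>t<s. inverse (of_nat (a s) - of_nat (a t)))"
    unfolding newton_poly_def by (rule prod_inversef[symmetric, unfolded o_def])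
  also have "\<dots> \<in> R"
    by (intro closed inverse_diff_closed) (use Suc.prems(2) ne in auto)
  finally have inv: "inverse (?N s s) \<in> R" .
  \<comment> \<open>The new coefficient corrects the error at the new node. Its Newton polynomial
    vanishes at the earlier nodes, so the values there are unchanged.\<close>
  define c' where "c' = c(s := inverse (?N s s) * (f s - (\<Sum>j<s. c j * ?N j s)))"
  have "c' j \<in> R" for j
    unfolding c'_def using c(1) inv Suc.prems(3)
    by (auto intro!: closed newton_poly_closed)
  moreover have "f i = (\<Sum>j<Suc s. c' j * ?N j i)" if "i < Suc s" for i
  proof (cases "i = s")
    case True
    then show ?thesis using nz by (simp add: c'_def field_simps)
  next
    case False
    with that have "i < s" by simp
    then have "?N s i = 0" using newton_poly_node_eq_0[of i s "\<lambda>t. of_nat (a t)"] by simp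
    then show ?thesis using c(2)[OF \<open>i < s\<close>] by (simp add: c'_def)
  qed
  ultimately show ?case by blast
qed

text \<open>In the binomial expansion, each binomial coefficient with \<open>k < n\<close> is
  rewritten as a polynomial in \<open>u\<close> of degree \<open>k\<close>. Only
  \<open>k \<ge> l\<close> contributes to \<open>u ^ l\<close>, so \<open>\<pi> ^ l\<close> can be
  extracted, and the term \<open>k = l\<close> gives the leading part of \<open>D l\<close>. All
  terms with \<open>k \<ge> n\<close> go into the remainder.\<close>

lemma power_one_minus_pi_expansion:
  obtains D r where "\<And>l. D l \<in> R" and "\<And>u. r u \<in> R"
    and "\<And>l. l < n \<Longrightarrow> \<exists>\<delta>\<in>R. D l = (-1) ^ l / fact l + \<pi> * \<delta>"
    and "\<And>u::nat. (1 - \<pi>) ^ u = (\<Sum>l<n. \<pi> ^ l * D l * of_nat u ^ l) + \<pi> ^ n * r u"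
proof -
  define \<sigma> :: "nat \<Rightarrow> nat \<Rightarrow> 'a" where "\<sigma> k l = of_int (coeff (falling_poly k) l)" for k l
  define D where "D l = (\<Sum>k\<in>{l..<n}. (-1) ^ k * \<pi> ^ (k - l) * inverse (fact k) * \<sigma> k l)" for l
  \<comment> \<open>The remainder keeps the binomial coefficients as integers, since factorials of
    \<open>k \<ge> n\<close> may fail to be invertible in \<open>R\<close>.\<close>
  define r where "r u = (\<Sum>k\<in>{n..<n + Suc u}. of_nat (u choose k) * (-1) ^ k * \<pi> ^ (k - n))" for u :: nat
  have \<sigma>: "\<sigma> k l \<in> R" for k l by (simp add: \<sigma>_def)
  have D: "D l \<in> R" for l
    unfolding D_def by (intro closed \<sigma> inverse_fact_closed) auto
  have r: "r u \<in> R" for u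
    unfolding r_def by (intro closed) auto
  have lead: "\<exists>\<delta>\<in>R. D l = (-1) ^ l / fact l + \<pi> * \<delta>" if "l < n" for l
  proof
    let ?\<delta> = "\<Sum>k\<in>{Suc l..<n}. (-1) ^ k * \<pi> ^ (k - Suc l) * inverse (fact k) * \<sigma> k l"
    show "?\<delta> \<in> R" by (intro closed \<sigma> inverse_fact_closed) auto
    have "D l = (-1) ^ l * inverse (fact l) +
        (\<Sum>k\<in>{Suc l..<n}. (-1) ^ k * \<pi> ^ (k - l) * inverse (fact k) * \<sigma> k l)"
      using that by (simp add: D_def sum.atLeast_Suc_lessThan \<sigma>_def coeff_falling_poly_self)
    also have "(\<Sum>k\<in>{Suc l..<n}. (-1) ^ k * \<pi> ^ (k - l) * inverse (fact k) * \<sigma> k l) = \<pi> * ?\<delta>"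
      unfolding sum_distrib_left
    proof (intro sum.cong refl)
      fix k assume "k \<in> {Suc l..<n}"
      then have "k - l = Suc (k - Suc l)" by auto
      then show "(-1) ^ k * \<pi> ^ (k - l) * inverse (fact k) * \<sigma> k l =
          \<pi> * ((-1) ^ k * \<pi> ^ (k - Suc l) * inverse (fact k) * \<sigma> k l)"
        by (simp only: power_Suc mult_ac)
    qed
    finally show "D l = (-1) ^ l / fact l + \<pi> * ?\<delta>" by (simp add: divide_inverse)
  qed
  have expand: "(1 - \<pi>) ^ u = (\<Sum>l<n. \<pi> ^ l * D l * of_nat u ^ l) + \<pi> ^ n * r u" for u :: nat
  proof -
    let ?b = "\<lambda>k. of_nat (u choose k) * (- \<pi>) ^ k"
    have "(1 - \<pi>) ^ u = (\<Sum>k\<le>u. ?b k)"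
      using binomial_ring[of "- \<pi>" 1 u] by simp
    \<comment> \<open>The range is padded with zero terms so that it can be split at
      \<open>n\<close> whether or not \<open>u\<close> reaches \<open>n\<close>.\<close>
    also have "\<dots> = (\<Sum>k<n + Suc u. ?b k)"
      by (rule sum.mono_neutral_left) auto
    also have "\<dots> = (\<Sum>k<n. ?b k) + (\<Sum>k\<in>{n..<n + Suc u}. ?b k)"
      using sum.atLeastLessThan_concat[of 0 n "n + Suc u" ?b] by (simp add: atLeast0LessThan)
    also have "(\<Sum>k\<in>{n..<n + Suc u}. ?b k) = \<pi> ^ n * r u"
      unfolding r_def sum_distrib_left
    proof (intro sum.cong refl)
      fix k assume "k \<in> {n..<n + Suc u}"
      then have "\<pi> ^ k = \<pi> ^ n * \<pi> ^ (k - n)" by (simp flip: power_add)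
      then show "?b k = \<pi> ^ n * (of_nat (u choose k) * (-1) ^ k * \<pi> ^ (k - n))"
        by (simp add: power_minus[of \<pi>])
    qed
    also have "(\<Sum>k<n. ?b k) = (\<Sum>k<n. \<Sum>l\<le>k. (- \<pi>) ^ k * inverse (fact k) * \<sigma> k l * of_nat u ^ l)"
      by (simp add: binomial_eq_falling_poly \<sigma>_def sum_distrib_left sum_distrib_right
          divide_inverse mult_ac)
    also have "\<dots> = (\<Sum>k<n. \<Sum>l<n. (- \<pi>) ^ k * inverse (fact k) * \<sigma> k l * of_nat u ^ l)"
      by (intro sum.cong refl sum.mono_neutral_left)
         (auto simp: \<sigma>_def coeff_eq_0 degree_falling_poly)
    also have "\<dots> = (\<Sum>l<n. \<Sum>k<n. (- \<pi>) ^ k * inverse (fact k) * \<sigma> k l * of_nat u ^ l)"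
      by (rule sum.swap)
    \<comment> \<open>The degree of \<open>falling_poly k\<close> is \<open>k\<close>, so the terms
      with \<open>k < l\<close> vanish.\<close>
    also have "\<dots> = (\<Sum>l<n. \<Sum>k\<in>{l..<n}. (- \<pi>) ^ k * inverse (fact k) * \<sigma> k l * of_nat u ^ l)"
      by (intro sum.cong refl sum.mono_neutral_right)
         (auto simp: \<sigma>_def coeff_eq_0 degree_falling_poly)
    also have "\<dots> = (\<Sum>l<n. \<pi> ^ l * D l * of_nat u ^ l)"
    proof (intro sum.cong refl)
      fix l
      show "(\<Sum>k\<in>{l..<n}. (- \<pi>) ^ k * inverse (fact k) * \<sigma> k l * of_nat u ^ l) =
          \<pi> ^ l * D l * of_nat u ^ l"
        unfolding D_def sum_distrib_left sum_distrib_right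
      proof (intro sum.cong refl)
        fix k assume "k \<in> {l..<n}"
        then have "\<pi> ^ k = \<pi> ^ l * \<pi> ^ (k - l)" by (simp flip: power_add)
        then show "(- \<pi>) ^ k * inverse (fact k) * \<sigma> k l * of_nat u ^ l =
            \<pi> ^ l * ((-1) ^ k * \<pi> ^ (k - l) * inverse (fact k) * \<sigma> k l) * of_nat u ^ l"
          by (simp add: power_minus[of \<pi>])
      qed
    qed
    finally show ?thesis .
  qed
  from D r lead expand show ?thesis by (rule that)
qed

text \<open>Interpolate in \<open>i\<close> for each fixed \<open>j\<close>, then interpolate the
  resulting coefficients in \<open>j\<close>.\<close>

lemma newton_interpolation2:
  assumes a: "inj_on a {..<s}" "\<And>i. i < s \<Longrightarrow> a i < n"
    and b: "inj_on b {..<t}" "\<And>j. j < t \<Longrightarrow> b j < n"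
    and f: "\<And>i j. f i j \<in> R"
  obtains c where "\<And>i j. c i j \<in> R"
    and "\<And>i j. i < s \<Longrightarrow> j < t \<Longrightarrow> f i j =
      (\<Sum>i'<s. \<Sum>j'<t. newton_poly (\<lambda>t. of_nat (a t)) i' (of_nat (a i)) * c i' j' *
        newton_poly (\<lambda>t. of_nat (b t)) j' (of_nat (b j)))"
proof -
  let ?N = "\<lambda>j i. newton_poly (\<lambda>t. of_nat (a t)) j (of_nat (a i) :: 'a)"
  let ?M = "\<lambda>j i. newton_poly (\<lambda>t. of_nat (b t)) j (of_nat (b i) :: 'a)"
  have ex: "\<forall>j. \<exists>c. (\<forall>i'. c i' \<in> R) \<and> (\<forall>i<s. f i j = (\<Sum>i'<s. c i' * ?N i' i))"
    by (intro allI newton_interpolation a f)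
  then obtain c where c: "\<And>j i'. c j i' \<in> R" "\<And>j i. i < s \<Longrightarrow> f i j = (\<Sum>i'<s. c j i' * ?N i' i)"
    using choice[OF ex] by blast
  have ex': "\<forall>i'. \<exists>e. (\<forall>j'. e j' \<in> R) \<and> (\<forall>j<t. c j i' = (\<Sum>j'<t. e j' * ?M j' j))"
    by (intro allI newton_interpolation b c)
  then obtain e where e: "\<And>i' j'. e i' j' \<in> R" "\<And>i' j. j < t \<Longrightarrow> c j i' = (\<Sum>j'<t. e i' j' * ?M j' j)"
    using choice[OF ex'] by blast
  have "f i j = (\<Sum>i'<s. \<Sum>j'<t. ?N i' i * e i' j' * ?M j' j)" if "i < s" "j < t" for i j
    using that by (simp add: c(2) e(2) sum_distrib_left sum_distrib_right mult_ac)
  with e(1) show ?thesis by (rule that)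
qed

text \<open>For \<open>u = a i * b j\<close> the power \<open>u ^ l\<close> splits, and each factor
  is expanded in its Newton basis. The coefficient of index \<open>i'\<close> in an
  \<open>l\<close>-th power vanishes for \<open>l < i'\<close>, so only
  \<open>l \<ge> max i' j'\<close> contributes and \<open>\<pi> ^ max i' j'\<close> comes out. The
  remainder, already a multiple of \<open>\<pi> ^ n\<close>, is interpolated.\<close>

lemma power_one_minus_pi_block:
  assumes a: "inj_on a {..<s}" "\<And>i. i < s \<Longrightarrow> a i < n"
    and b: "inj_on b {..<t}" "\<And>j. j < t \<Longrightarrow> b j < n"
  obtains E where "\<And>i j. E i j \<in> R"
    and "\<And>k. k < min s t \<Longrightarrow> \<exists>\<delta>\<in>R. E k k = (-1) ^ k / fact k + \<pi> * \<delta>"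
    and "\<And>i j. i < s \<Longrightarrow> j < t \<Longrightarrow> (1 - \<pi>) ^ (a i * b j) =
      (\<Sum>i'<s. \<Sum>j'<t. newton_poly (\<lambda>t. of_nat (a t)) i' (of_nat (a i)) *
        (\<pi> ^ max i' j' * E i' j') * newton_poly (\<lambda>t. of_nat (b t)) j' (of_nat (b j)))"
proof -
  let ?a = "\<lambda>t. of_nat (a t) :: 'a" and ?b = "\<lambda>t. of_nat (b t) :: 'a"
  let ?N = "\<lambda>j i. newton_poly ?a j (?a i)" and ?M = "\<lambda>j i. newton_poly ?b j (?b i)"
  let ?c = "newton_coeff ?a" and ?d = "newton_coeff ?b"
  \<comment> \<open>The nodes are distinct numbers below \<open>n\<close>. Hence every index
    occurring is below \<open>n\<close>, and \<open>\<pi> ^ n\<close> is divisible by the power to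
    be extracted.\<close>
  have sn: "s \<le> n" using card_inj_on_le[of a "{..<s}" "{..<n}"] a by auto
  have tn: "t \<le> n" using card_inj_on_le[of b "{..<t}" "{..<n}"] b by auto
  obtain D r where D: "\<And>l. D l \<in> R" and r: "\<And>u. r u \<in> R"
    and lead: "\<And>l. l < n \<Longrightarrow> \<exists>\<delta>\<in>R. D l = (-1) ^ l / fact l + \<pi> * \<delta>"
    and expand: "\<And>u::nat. (1 - \<pi>) ^ u = (\<Sum>l<n. \<pi> ^ l * D l * of_nat u ^ l) + \<pi> ^ n * r u"
    by (rule power_one_minus_pi_expansion) blast
  obtain e where e: "\<And>i j. e i j \<in> R"
    and re: "\<And>i j. i < s \<Longrightarrow> j < t \<Longrightarrow> r (a i * b j) = (\<Sum>i'<s. \<Sum>j'<t. ?N i' i * e i' j' * ?M j' j)"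
    by (rule newton_interpolation2[OF a b, where f = "\<lambda>i j. r (a i * b j)"]) (use r in blast)+
  have c: "?c l i \<in> R" and d: "?d l i \<in> R" for l i by (intro newton_coeff_closed; simp)+
  \<comment> \<open>The coefficient after removal of \<open>\<pi> ^ max i j\<close>, written without
    division because \<open>\<pi>\<close> may be zero.\<close>
  define E where "E i j = (\<Sum>l\<in>{max i j..<n}. \<pi> ^ (l - max i j) * D l * ?c l i * ?d l j)
      + \<pi> ^ (n - max i j) * e i j" for i j
  have E: "E i j \<in> R" for i j
    unfolding E_def by (intro closed c d D e pi_closed)
  have E_lead: "\<exists>\<delta>\<in>R. E k k = (-1) ^ k / fact k + \<pi> * \<delta>" if "k < min s t" for k
  proof -
    have "k < n" using that sn by simp
    then obtain \<delta> where \<delta>: "\<delta> \<in> R" "D k = (-1) ^ k / fact k + \<pi> * \<delta>" using lead by blast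
    let ?\<epsilon> = "\<delta> + (\<Sum>l\<in>{Suc k..<n}. \<pi> ^ (l - Suc k) * D l * ?c l k * ?d l k) + \<pi> ^ (n - Suc k) * e k k"
    \<comment> \<open>The term \<open>l = k\<close> is exactly \<open>D k\<close>, as both Newton
      coefficients are 1 there; everything else carries a factor \<open>\<pi>\<close>.\<close>
    have "E k k = D k + (\<Sum>l\<in>{Suc k..<n}. \<pi> ^ (l - k) * D l * ?c l k * ?d l k) + \<pi> ^ (n - k) * e k k"
      using \<open>k < n\<close> by (simp add: E_def sum.atLeast_Suc_lessThan)
    also have "(\<Sum>l\<in>{Suc k..<n}. \<pi> ^ (l - k) * D l * ?c l k * ?d l k) =
        \<pi> * (\<Sum>l\<in>{Suc k..<n}. \<pi> ^ (l - Suc k) * D l * ?c l k * ?d l k)"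
      unfolding sum_distrib_left
    proof (intro sum.cong refl)
      fix l assume "l \<in> {Suc k..<n}"
      then have "l - k = Suc (l - Suc k)" by auto
      then show "\<pi> ^ (l - k) * D l * ?c l k * ?d l k = \<pi> * (\<pi> ^ (l - Suc k) * D l * ?c l k * ?d l k)"
        by (simp only: power_Suc mult_ac)
    qed
    also have "\<pi> ^ (n - k) = \<pi> * \<pi> ^ (n - Suc k)"
      using \<open>k < n\<close> by (simp add: Suc_diff_Suc flip: power_Suc)
    finally have "E k k = (-1) ^ k / fact k + \<pi> * ?\<epsilon>"
      by (simp add: \<delta>(2) algebra_simps)
    moreover have "?\<epsilon> \<in> R" by (intro closed c d D e \<delta> pi_closed)
    ultimately show ?thesis by blast
  qed
  have piE: "\<pi> ^ max i j * E i j = (\<Sum>l<n. \<pi> ^ l * D l * ?c l i * ?d l j) + \<pi> ^ n * e i j"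
    if "i < s" "j < t" for i j
  proof -
    have m: "max i j \<le> n" using that sn tn by simp
    have "(\<Sum>l<n. \<pi> ^ l * D l * ?c l i * ?d l j) = (\<Sum>l\<in>{max i j..<n}. \<pi> ^ l * D l * ?c l i * ?d l j)"
      by (rule sum.mono_neutral_right) (auto simp: newton_coeff_eq_0 not_le)
    also have "\<dots> = \<pi> ^ max i j * (\<Sum>l\<in>{max i j..<n}. \<pi> ^ (l - max i j) * D l * ?c l i * ?d l j)"
      unfolding sum_distrib_left
    proof (intro sum.cong refl)
      fix l assume "l \<in> {max i j..<n}"
      then have "\<pi> ^ l = \<pi> ^ max i j * \<pi> ^ (l - max i j)" by (subst power_add[symmetric]) auto
      then show "\<pi> ^ l * D l * ?c l i * ?d l j = \<pi> ^ max i j * (\<pi> ^ (l - max i j) * D l * ?c l i * ?d l j)"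
        by (simp only: mult_ac)
    qed
    moreover have "\<pi> ^ n = \<pi> ^ max i j * \<pi> ^ (n - max i j)"
      using m by (subst power_add[symmetric]) auto
    ultimately show ?thesis by (simp add: E_def distrib_left mult_ac)
  qed
  have "(1 - \<pi>) ^ (a i * b j) = (\<Sum>i'<s. \<Sum>j'<t. ?N i' i * (\<pi> ^ max i' j' * E i' j') * ?M j' j)"
    if ij: "i < s" "j < t" for i j
  proof -
    have "\<pi> ^ l * D l * of_nat (a i * b j) ^ l =
        (\<Sum>i'<s. \<Sum>j'<t. ?N i' i * (\<pi> ^ l * D l * ?c l i' * ?d l j') * ?M j' j)" for l
    proof -
      have "(of_nat (a i * b j) :: 'a) ^ l = (\<Sum>i'<s. ?c l i' * ?N i' i) * (\<Sum>j'<t. ?d l j' * ?M j' j)"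
        by (simp add: power_mult_distrib power_node_eq_sum_newton[of i s ?a l, OF ij(1)]
            power_node_eq_sum_newton[of j t ?b l, OF ij(2)])
      then have "\<pi> ^ l * D l * of_nat (a i * b j) ^ l =
          \<pi> ^ l * D l * ((\<Sum>i'<s. ?c l i' * ?N i' i) * (\<Sum>j'<t. ?d l j' * ?M j' j))"
        by (simp only:)
      also have "\<dots> = (\<Sum>i'<s. \<Sum>j'<t. ?N i' i * (\<pi> ^ l * D l * ?c l i' * ?d l j') * ?M j' j)"
        unfolding sum_product unfolding sum_distrib_left
        by (intro sum.cong refl) (simp only: mult_ac)
      finally show ?thesis .
    qed
    then have "(\<Sum>l<n. \<pi> ^ l * D l * of_nat (a i * b j) ^ l) =
        (\<Sum>l<n. \<Sum>i'<s. \<Sum>j'<t. ?N i' i * (\<pi> ^ l * D l * ?c l i' * ?d l j') * ?M j' j)"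
      by simp
    also have "\<dots> = (\<Sum>i'<s. \<Sum>j'<t. \<Sum>l<n. ?N i' i * (\<pi> ^ l * D l * ?c l i' * ?d l j') * ?M j' j)"
      by (rule trans[OF sum.swap sum.cong[OF refl sum.swap]])
    finally have "(1 - \<pi>) ^ (a i * b j) = (\<Sum>i'<s. \<Sum>j'<t. ?N i' i *
        ((\<Sum>l<n. \<pi> ^ l * D l * ?c l i' * ?d l j') + \<pi> ^ n * e i' j') * ?M j' j)"
      unfolding expand re[OF ij]
      by (simp add: sum.distrib distrib_left distrib_right sum_distrib_left sum_distrib_right mult_ac)
    also have "\<dots> = (\<Sum>i'<s. \<Sum>j'<t. ?N i' i * (\<pi> ^ max i' j' * E i' j') * ?M j' j)"
      by (intro sum.cong refl) (simp add: piE)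
    finally show ?thesis .
  qed
  with E E_lead show ?thesis by (rule that)
qed

text \<open>Nonvanishing is detected modulo \<open>P\<close>: primality keeps a product of block
  determinants outside \<open>P\<close>, and anything congruent to such a product is
  nonzero.\<close>

lemma kronecker_minor_nonzero:
  fixes F :: "'g \<Rightarrow> 'g \<Rightarrow> 'a"
  assumes G: "finite G" and F: "\<And>g h. g \<in> G \<Longrightarrow> h \<in> G \<Longrightarrow> F g h \<in> R"
    and minors: "\<And>T. T \<subseteq> G \<Longrightarrow> leibniz_det T F \<notin> P"
    and S: "S \<subseteq> G \<times> {0..<n}"
  shows "leibniz_det S (\<lambda>p q. F (fst p) (fst q) * (1 - \<pi>) ^ (snd p * snd q)) \<noteq> 0"
proof -
  define sz where "sz g = card {a. (g, a) \<in> S}" for g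
  have fibre: "{a. (g, a) \<in> S} \<subseteq> {0..<n}" for g using S by auto
  then have "finite {a. (g, a) \<in> S}" for g by (rule finite_subset) simp
  then have "\<forall>g. \<exists>f. bij_betw f {0..<sz g} {a. (g, a) \<in> S}"
    unfolding sz_def by (intro allI ex_bij_betw_nat_finite)
  then obtain al where al: "\<And>g. bij_betw (al g) {..<sz g} {a. (g, a) \<in> S}"
    unfolding atLeast0LessThan by metis
  have al_S: "(g, al g i) \<in> S" if "i < sz g" for g i
    using bij_betwE[OF al[of g]] that by auto
  have al_inj: "inj_on (al g) {..<sz g}" for g using al[of g] by (rule bij_betw_imp_inj_on)
  have al_n: "al g i < n" if "i < sz g" for g i using al_S[OF that] S by auto
  have sz_n: "sz g \<le> n" for g
    unfolding sz_def using card_mono[OF _ fibre[of g]] by simp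
  \<comment> \<open>The pair \<open>(g, i)\<close> stands for the \<open>i\<close>-th element of the
    fibre over \<open>g\<close>; its second component is the level used for both triangularity
    arguments.\<close>
  define T where "T = Sigma G (\<lambda>g. {..<sz g})"
  have T: "finite T" unfolding T_def using G by simp
  have bij: "bij_betw (\<lambda>p. (fst p, al (fst p) (snd p))) T S"
  proof (rule bij_betwI')
    fix p q assume "p \<in> T" "q \<in> T"
    then show "((fst p, al (fst p) (snd p)) = (fst q, al (fst q) (snd q))) = (p = q)"
      unfolding T_def by (auto simp: inj_on_eq_iff[OF al_inj])
  next
    fix p assume "p \<in> T"
    then show "(fst p, al (fst p) (snd p)) \<in> S" unfolding T_def by (auto intro: al_S)
  next
    fix q assume "q \<in> S"
    then have "snd q \<in> al (fst q) ` {..<sz (fst q)}"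
      using al[of "fst q"] by (simp add: bij_betw_def)
    then obtain i where "i < sz (fst q)" "snd q = al (fst q) i" by auto
    with \<open>q \<in> S\<close> S show "\<exists>p\<in>T. q = (fst p, al (fst p) (snd p))"
      unfolding T_def by (intro bexI[of _ "(fst q, i)"]) (auto simp: prod_eq_iff)
  qed
  let ?N = "\<lambda>g j i. newton_poly (\<lambda>t. of_nat (al g t)) j (of_nat (al g i)) :: 'a"
  \<comment> \<open>Bundling the properties of one block allows \<open>E\<close> to be chosen
    simultaneously for all pairs of fibres.\<close>
  define Q where "Q g h E \<longleftrightarrow> (\<forall>i j. E i j \<in> R) \<and>
    (\<forall>k<min (sz g) (sz h). \<exists>\<delta>\<in>R. E k k = (-1) ^ k / fact k + \<pi> * \<delta>) \<and>
    (\<forall>i<sz g. \<forall>j<sz h. (1 - \<pi>) ^ (al g i * al h j) =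
      (\<Sum>i'<sz g. \<Sum>j'<sz h. ?N g i' i * (\<pi> ^ max i' j' * E i' j') * ?N h j' j))" for g h E
  have "\<exists>E. Q g h E" for g h
  proof -
    obtain E where "\<And>i j. E i j \<in> R"
      and "\<And>k. k < min (sz g) (sz h) \<Longrightarrow> \<exists>\<delta>\<in>R. E k k = (-1) ^ k / fact k + \<pi> * \<delta>"
      and "\<And>i j. i < sz g \<Longrightarrow> j < sz h \<Longrightarrow> (1 - \<pi>) ^ (al g i * al h j) =
        (\<Sum>i'<sz g. \<Sum>j'<sz h. ?N g i' i * (\<pi> ^ max i' j' * E i' j') * ?N h j' j)"
      by (rule power_one_minus_pi_block[of "al g" "sz g" "al h" "sz h"]) (use al_inj al_n in blast)+
    then have "Q g h E" unfolding Q_def by blast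
    then show ?thesis by (rule exI[of "Q g h"])
  qed
  then obtain E where Q: "\<And>g h. Q g h (E g h)" by metis
  have E: "E g h i j \<in> R" for g h i j
    using Q[of g h] unfolding Q_def by blast
  have E_lead: "\<exists>\<delta>\<in>R. E g h k k = (-1) ^ k / fact k + \<pi> * \<delta>" if "k < sz g" "k < sz h" for g h k
    using Q[of g h] that unfolding Q_def by simp
  have E_sum: "(1 - \<pi>) ^ (al g i * al h j) =
      (\<Sum>i'<sz g. \<Sum>j'<sz h. ?N g i' i * (\<pi> ^ max i' j' * E g h i' j') * ?N h j' j)"
    if "i < sz g" "j < sz h" for g h i j
    using Q[of g h] that unfolding Q_def by blast
  define A where "A p r = (if fst p = fst r then ?N (fst p) (snd r) (snd p) else 0)" for p r
  define B where "B p q = F (fst p) (fst q) * (\<pi> ^ max (snd p) (snd q) * E (fst p) (fst q) (snd p) (snd q))"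
    for p q
  \<comment> \<open>What remains of \<open>B\<close> once \<open>\<pi> ^ i\<close> is taken out of
    each row \<open>(g, i)\<close>. The exponent is zero unless the column has the higher
    level.\<close>
  define B' where "B' p q = F (fst p) (fst q) *
    (\<pi> ^ (max (snd p) (snd q) - snd p) * E (fst p) (fst q) (snd p) (snd q))" for p q
  \<comment> \<open>A representative of \<open>B'\<close> modulo \<open>P\<close>: entries with
    higher column level are dropped, those of equal level keep only the leading term of
    \<open>E\<close>.\<close>
  define B'' where "B'' p q = (if snd p < snd q then 0
    else if snd p = snd q then (-1) ^ snd p / fact (snd p) * F (fst p) (fst q) else B' p q)" for p q
  have sumT: "(\<Sum>r\<in>T. A p r * f r) = (\<Sum>i<sz (fst p). ?N (fst p) i (snd p) * f (fst p, i))"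
    if "p \<in> T" for p f
  proof -
    have "(\<Sum>r\<in>T. A p r * f r) = (\<Sum>g\<in>G. \<Sum>i<sz g. A p (g, i) * f (g, i))"
      unfolding T_def using G by (subst sum.Sigma) (auto simp: case_prod_beta)
    also have "\<dots> = (\<Sum>g\<in>G. if g = fst p then (\<Sum>i<sz g. ?N g i (snd p) * f (g, i)) else 0)"
      by (intro sum.cong refl) (auto simp: A_def)
    also have "\<dots> = (\<Sum>i<sz (fst p). ?N (fst p) i (snd p) * f (fst p, i))"
      using that G by (subst sum.delta) (auto simp: T_def)
    finally show ?thesis .
  qed
  have "leibniz_det S (\<lambda>p q. F (fst p) (fst q) * (1 - \<pi>) ^ (snd p * snd q)) =
      leibniz_det T (\<lambda>p q. F (fst p) (fst q) * (1 - \<pi>) ^ (al (fst p) (snd p) * al (fst q) (snd q)))"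
    by (simp add: leibniz_det_reindex[OF bij T])
  also have "\<dots> = leibniz_det T (\<lambda>p q. \<Sum>r\<in>T. A p r * (\<Sum>r'\<in>T. B r r' * A q r'))"
  proof (rule leibniz_det_cong)
    fix p q assume pq: "p \<in> T" "q \<in> T"
    then have "snd p < sz (fst p)" "snd q < sz (fst q)" by (auto simp: T_def)
    note E_sum = E_sum[OF this]
    have inner: "(\<Sum>r'\<in>T. B r r' * A q r') =
        (\<Sum>j<sz (fst q). ?N (fst q) j (snd q) * B r (fst q, j))" for r
      using sumT[OF pq(2), of "B r"] by (simp add: mult.commute)
    have "(\<Sum>r\<in>T. A p r * (\<Sum>r'\<in>T. B r r' * A q r')) =
        (\<Sum>i<sz (fst p). ?N (fst p) i (snd p) *
          (\<Sum>j<sz (fst q). ?N (fst q) j (snd q) * B (fst p, i) (fst q, j)))"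
      by (simp only: sumT[OF pq(1)] inner)
    also have "\<dots> = F (fst p) (fst q) * (1 - \<pi>) ^ (al (fst p) (snd p) * al (fst q) (snd q))"
      unfolding E_sum B_def fst_conv snd_conv sum_distrib_left
      by (intro sum.cong refl) (simp only: mult_ac)
    finally show "F (fst p) (fst q) * (1 - \<pi>) ^ (al (fst p) (snd p) * al (fst q) (snd q)) =
        (\<Sum>r\<in>T. A p r * (\<Sum>r'\<in>T. B r r' * A q r'))" ..
  qed
  also have "\<dots> = leibniz_det T A * (leibniz_det T B * leibniz_det T A)"
    using T by (simp add: leibniz_det_mult leibniz_det_transpose[of T A])
  finally have det: "leibniz_det S (\<lambda>p q. F (fst p) (fst q) * (1 - \<pi>) ^ (snd p * snd q)) =
    leibniz_det T A * (leibniz_det T B * leibniz_det T A)" .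

  \<comment> \<open>Within a fibre, a Newton polynomial vanishes at every node of smaller index;
    between different fibres \<open>A\<close> is zero by definition, which also settles equal
    levels.\<close>
  have "leibniz_det T A = (\<Prod>p\<in>T. A p p)"
  proof (rule leibniz_det_triangular[where l = snd])
    fix p q assume "p \<in> T" "q \<in> T" "p \<noteq> q" "snd p \<le> snd q"
    then show "A p q = 0"
      by (auto simp: A_def prod_eq_iff intro!: newton_poly_node_eq_0)
  qed (rule T)
  moreover have "A p p \<noteq> 0" if "p \<in> T" for p
  proof -
    have "al (fst p) (snd p) \<noteq> al (fst p) t" if "t < snd p" for t
      using \<open>p \<in> T\<close> that inj_onD[OF al_inj[of "fst p"], of "snd p" t] by (auto simp: T_def)
    then show ?thesis by (simp add: A_def newton_poly_def)
  qed
  ultimately have detA: "leibniz_det T A \<noteq> 0" using T by simp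

  have lt_n: "snd p < n" if "p \<in> T" for p
    using that sz_n[of "fst p"] by (auto simp: T_def)
  have "leibniz_det T B = leibniz_det T (\<lambda>p q. \<pi> ^ snd p * B' p q)"
  proof (rule leibniz_det_cong)
    fix p q :: "'g \<times> nat"
    have "\<pi> ^ max (snd p) (snd q) = \<pi> ^ snd p * \<pi> ^ (max (snd p) (snd q) - snd p)"
      by (subst power_add[symmetric]) simp
    then show "B p q = \<pi> ^ snd p * B' p q" by (simp add: B_def B'_def)
  qed
  then have detB: "leibniz_det T B = (\<Prod>p\<in>T. \<pi> ^ snd p) * leibniz_det T B'"
    by (simp add: leibniz_det_scale_rows)
  \<comment> \<open>A positive level forces \<open>n > 1\<close>, hence
    \<open>\<pi> \<noteq> 0\<close>. At level 0 the power is 1 even when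
    \<open>\<pi> = 0\<close>.\<close>
  have "\<pi> ^ snd p \<noteq> 0" if "p \<in> T" for p
    using pi_nz lt_n[OF that] by (cases "snd p = 0") auto
  then have pi_prod: "(\<Prod>p\<in>T. \<pi> ^ snd p) \<noteq> 0" using T by simp

  have unit: "(-1) ^ k / fact k \<in> R" "(-1) ^ k / fact k \<notin> P" if "k < n" for k
  proof -
    show "(-1) ^ k / fact k \<in> R"
      unfolding divide_inverse by (intro closed inverse_fact_closed that) simp
    have "(-1) ^ k * fact k * ((-1) ^ k / fact k :: 'a) = 1"
      by (simp flip: power_mult_distrib)
    moreover have "(fact k :: 'a) \<in> R" using of_nat_closed[of "fact k"] by simp
    then have "(-1) ^ k * (fact k :: 'a) \<in> R" by (intro closed) auto
    ultimately show "(-1) ^ k / fact k \<notin> P" by (intro unit_notin_P) auto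
  qed
  have FT: "F (fst p) (fst q) \<in> R" if "p \<in> T" "q \<in> T" for p q
    using that by (auto simp: T_def intro: F)
  have B'R: "B' p q \<in> R" if "p \<in> T" "q \<in> T" for p q
    unfolding B'_def using that by (intro closed FT E pi_closed)
  have B''R: "B'' p q \<in> R" if "p \<in> T" "q \<in> T" for p q
    using mult_closed[OF unit(1)[OF lt_n[OF that(1)]] FT[OF that]] B'R[OF that]
    by (auto simp: B''_def)
  have diff: "B' p q - B'' p q \<in> P" if pq: "p \<in> T" "q \<in> T" for p q
  proof -
    consider "snd p < snd q" | "snd p = snd q" | "snd p > snd q" by linarith
    then show ?thesis
    proof cases
      case 1
      then have "max (snd p) (snd q) - snd p = Suc (snd q - Suc (snd p))" by auto
      then have "B' p q - B'' p q =
          \<pi> * (F (fst p) (fst q) * (\<pi> ^ (snd q - Suc (snd p)) * E (fst p) (fst q) (snd p) (snd q)))"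
        using 1 by (simp add: B'_def B''_def)
      also have "\<dots> \<in> P" using pq by (intro imageI closed FT E pi_closed)
      finally show ?thesis .
    next
      case 2
      obtain \<delta> where \<delta>: "\<delta> \<in> R"
        "E (fst p) (fst q) (snd p) (snd q) = (-1) ^ snd p / fact (snd p) + \<pi> * \<delta>"
        using E_lead[of "snd p" "fst p" "fst q"] pq 2 by (auto simp: T_def)
      have "B' p q - B'' p q = \<pi> * (F (fst p) (fst q) * \<delta>)"
        using 2 \<delta>(2) by (simp add: B'_def B''_def algebra_simps)
      also have "\<dots> \<in> P" using pq \<delta> by (intro imageI closed FT)
      finally show ?thesis .
    next
      case 3
      then show ?thesis using zero_in_P by (simp add: B''_def del: image_iff)
    qed
  qed
  have "leibniz_det T B'' = (\<Prod>k<n. leibniz_det {p \<in> T. snd p = k} B'')"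
    by (rule leibniz_det_block_triangular) (auto simp: T lt_n B''_def)
  \<comment> \<open>Level \<open>k\<close> occurs once for each fibre with more than
    \<open>k\<close> elements, so the diagonal block is a scaled principal submatrix of
    \<open>F\<close>.\<close>
  also have "\<dots> = (\<Prod>k<n. leibniz_det {g \<in> G. k < sz g} (\<lambda>g h. (-1) ^ k / fact k * F g h))"
  proof (intro prod.cong refl)
    fix k
    have "bij_betw (\<lambda>g. (g, k)) {g \<in> G. k < sz g} {p \<in> T. snd p = k}"
      by (rule bij_betwI[where g = fst]) (auto simp: T_def)
    then show "leibniz_det {p \<in> T. snd p = k} B'' =
        leibniz_det {g \<in> G. k < sz g} (\<lambda>g h. (-1) ^ k / fact k * F g h)"
      by (subst leibniz_det_reindex) (auto simp: G B''_def)
  qed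
  also have "\<dots> = (\<Prod>k<n. (\<Prod>g\<in>{g \<in> G. k < sz g}. (-1) ^ k / fact k) * leibniz_det {g \<in> G. k < sz g} F)"
    by (simp only: leibniz_det_scale_rows)
  also have "\<dots> \<notin> P"
  proof (rule prod_notin_P)
    fix k assume "k \<in> {..<n}"
    then have k: "k < n" by simp
    let ?c = "\<Prod>g\<in>{g \<in> G. k < sz g}. (-1) ^ k / fact k" and ?d = "leibniz_det {g \<in> G. k < sz g} F"
    have cR: "?c \<in> R" by (intro closed unit k)
    have dR: "?d \<in> R" by (rule leibniz_det_closed) (auto intro: F)
    show "?c * ?d \<in> R" using cR dR by (rule mult_closed)
    have "?c \<notin> P" by (rule prod_notin_P) (use G unit k in \<open>auto simp del: image_iff\<close>)
    moreover have "?d \<notin> P" by (rule minors) auto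
    ultimately show "?c * ?d \<notin> P" using prime[OF cR dR] by blast
  qed simp
  finally have "leibniz_det T B'' \<notin> P" .
  moreover have "leibniz_det T B' - leibniz_det T B'' \<in> P"
    by (intro leibniz_det_cong_mod_P B'R B''R diff)
  \<comment> \<open>Otherwise the determinant of \<open>B''\<close> would be the negative of an
    element of \<open>P\<close>.\<close>
  ultimately have "leibniz_det T B' \<noteq> 0"
    using P_uminus[of "leibniz_det T B' - leibniz_det T B''"] by (auto simp del: image_iff)
  with det detA detB pi_prod show ?thesis by simp
qed

end

text \<open>Primality makes the complement of \<open>I\<close> closed under multiplication, and
  \<open>0 \<in> I\<close> makes its elements invertible in the field, so the localisation can be
  formed as a set of fractions there. The last conclusion says that no element of \<open>C\<close>
  outside \<open>I\<close> becomes a multiple of \<open>\<pi>\<close>; it carries the hypothesis on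
  minors over to \<open>L\<close>.\<close>

lemma localization_prime_element:
  fixes C :: "'a::field_char_0 set" and \<pi> :: 'a
  defines "I \<equiv> (*) \<pi> ` C"
  defines "L \<equiv> {r / s | r s. r \<in> C \<and> s \<in> C - I}"
  assumes one: "1 \<in> C"
    and add: "\<And>x y. x \<in> C \<Longrightarrow> y \<in> C \<Longrightarrow> x + y \<in> C"
    and uminus: "\<And>x. x \<in> C \<Longrightarrow> - x \<in> C"
    and mult: "\<And>x y. x \<in> C \<Longrightarrow> y \<in> C \<Longrightarrow> x * y \<in> C"
    and pi: "\<pi> \<in> C" and pi_nz: "n > 1 \<Longrightarrow> \<pi> \<noteq> 0"
    and one_notin: "1 \<notin> I"
    and prime: "\<And>x y. x \<in> C \<Longrightarrow> y \<in> C \<Longrightarrow> x * y \<in> I \<Longrightarrow> x \<in> I \<or> y \<in> I"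
    and nat: "\<And>k. 0 < k \<Longrightarrow> k < n \<Longrightarrow> of_nat k \<notin> I"
  shows "prime_element L \<pi> n" and "C \<subseteq> L" and "\<And>x. x \<in> C \<Longrightarrow> x \<in> (*) \<pi> ` L \<Longrightarrow> x \<in> I"
proof -
  have zero: "0 \<in> C" using add[OF one uminus[OF one]] by simp
  have zero_I: "0 \<in> I" unfolding I_def using zero by (auto intro!: image_eqI[of _ _ 0])
  have IC: "I \<subseteq> C" unfolding I_def using mult pi by auto
  have I_mult: "x * y \<in> I" if "x \<in> C" "y \<in> I" for x y
    using that mult unfolding I_def by (auto intro!: image_eqI[of "x * (\<pi> * z)" _ "x * z" for z])
  have den_mult: "s * t \<in> C - I" if "s \<in> C - I" "t \<in> C - I" for s t
    using that mult prime by blast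
  have den_nz: "s \<noteq> 0" if "s \<in> C - I" for s using that zero_I by auto
  have LI: "r / s \<in> L" if "r \<in> C" "s \<in> C - I" for r s
    unfolding L_def using that by blast
  have LE: "\<exists>r s. x = r / s \<and> r \<in> C \<and> s \<in> C - I" if "x \<in> L" for x
    using that unfolding L_def by blast
  have nat_C: "of_nat k \<in> C" for k by (induction k) (auto intro: zero one add)
  show CL: "C \<subseteq> L" using LI[of _ 1] one one_notin by auto
  have piL: "\<exists>r s. x = r / s \<and> r \<in> I \<and> s \<in> C - I" if x: "x \<in> (*) \<pi> ` L" for x
  proof -
    obtain y where y: "y \<in> L" "x = \<pi> * y" using x by blast
    obtain r s where rs: "y = r / s" "r \<in> C" "s \<in> C - I" using LE[OF y(1)] by blast
    then have "x = (\<pi> * r) / s" "\<pi> * r \<in> I" using y(2) by (auto simp: I_def)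
    with rs(3) show ?thesis by blast
  qed
  have Lpi: "r / s \<in> (*) \<pi> ` L" if r: "r \<in> I" and s: "s \<in> C - I" for r s
  proof -
    obtain y where y: "y \<in> C" "r = \<pi> * y" using r unfolding I_def by blast
    then have "r / s = \<pi> * (y / s)" by simp
    with LI[OF y(1) s] show ?thesis by blast
  qed
  \<comment> \<open>Clearing denominators puts \<open>t * x\<close> into \<open>I\<close> with
    \<open>t\<close> outside \<open>I\<close>, and primality applies.\<close>
  have descend: "x \<in> I" if x: "x \<in> C" "s \<in> C - I" "x / s \<in> (*) \<pi> ` L" for x s
  proof -
    obtain r t where rt: "x / s = r / t" "r \<in> I" "t \<in> C - I" using piL[OF x(3)] by blast
    have "t * x = s * r" using rt den_nz[OF x(2)] den_nz[OF rt(3)] by (simp add: field_simps)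
    also have "\<dots> \<in> I" using I_mult x(2) rt(2) by blast
    finally show ?thesis using prime[of t x] rt(3) x(1) by blast
  qed
  show descend1: "x \<in> I" if "x \<in> C" "x \<in> (*) \<pi> ` L" for x
    using descend[of x 1] that one one_notin by simp
  show "prime_element L \<pi> n"
  proof
    show "1 \<in> L" "\<pi> \<in> L" using CL one pi by auto
    show "1 \<notin> (*) \<pi> ` L" using descend1 one one_notin by blast
  next
    fix x y assume "x \<in> L" "y \<in> L"
    obtain r s where rs: "x = r / s" "r \<in> C" "s \<in> C - I" using LE[OF \<open>x \<in> L\<close>] by blast
    obtain t u where tu: "y = t / u" "t \<in> C" "u \<in> C - I" using LE[OF \<open>y \<in> L\<close>] by blast
    have su: "s * u \<in> C - I" using rs tu den_mult by blast
    have "x + y = (r * u + t * s) / (s * u)"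
      using rs(1) tu(1) den_nz[OF rs(3)] den_nz[OF tu(3)] by (simp add: field_simps)
    then show "x + y \<in> L" using LI[OF _ su, of "r * u + t * s"] rs tu add mult by auto
    have xy: "x * y = (r * t) / (s * u)" using rs(1) tu(1) by simp
    then show "x * y \<in> L" using LI[OF _ su, of "r * t"] rs tu mult by auto
    assume "x * y \<in> (*) \<pi> ` L"
    then have "r * t \<in> I" using descend[OF mult[OF rs(2) tu(2)] su] xy by simp
    then have "r \<in> I \<or> t \<in> I" using prime rs tu by blast
    then show "x \<in> (*) \<pi> ` L \<or> y \<in> (*) \<pi> ` L" using Lpi rs tu by blast
  next
    fix x assume "x \<in> L"
    then obtain r s where "x = r / s" "r \<in> C" "s \<in> C - I" using LE by blast
    then show "- x \<in> L" using LI[OF uminus, of r s] by simp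
  next
    fix k assume "0 < k" "k < n"
    then show "inverse (of_nat k) \<in> L"
      using LI[OF one, of "of_nat k"] nat nat_C by (simp add: divide_inverse)
  qed (rule pi_nz)
qed

section \<open>Cyclotomic rings and their quotients\<close>

lemma zeta_power: "zeta n ^ k = exp (2 * of_real pi * \<i> * of_nat k / of_nat n)"
  by (simp add: zeta_def exp_of_nat_mult[symmetric] mult_ac)

lemma zeta_mult_power:
  assumes "m > 0" and "n > 0"
  shows "zeta (m * n) ^ n = zeta m" and "zeta (m * n) ^ m = zeta n"
  using assms by (simp_all add: zeta_power) (simp_all add: zeta_def)

lemma zeta_power_self: "n > 0 \<Longrightarrow> zeta n ^ n = 1"
  by (simp add: zeta_power)

text \<open>The angle lies in the interval from 0 (excluded) to \<open>pi\<close>, where the cosine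
  is below 1, so the real parts differ.\<close>

lemma zeta_neq_1:
  assumes "n > 1"
  shows "zeta n \<noteq> 1"
proof -
  have "2 * pi / real n \<le> pi" using assms by (simp add: field_simps)
  moreover have "2 * pi / real n > 0" using assms by simp
  ultimately have "cos (2 * pi / real n) < cos 0"
    by (intro cos_monotone_0_pi) auto
  moreover have "zeta n = cis (2 * pi / real n)"
    by (simp add: zeta_def cis_conv_exp mult_ac)
  ultimately show ?thesis by (auto simp: complex_eq_iff)
qed

text \<open>The exponent is reduced modulo \<open>m\<close>. Natural powers visibly lie in the ring
  generated by a root of unity.\<close>

lemma zeta_power_int_eq_power:
  assumes "m > 0"
  shows "\<exists>j::nat. zeta m powi k = zeta m ^ j"
proof -
  have "zeta m \<noteq> 0" by (simp add: zeta_def)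
  have "zeta m powi k = zeta m powi (k mod int m + int m * (k div int m))" by simp
  also have "\<dots> = zeta m powi (k mod int m) * (zeta m ^ m) powi (k div int m)"
    using \<open>zeta m \<noteq> 0\<close> by (simp only: power_int_add power_int_mult power_int_of_nat simp_thms)
  also have "\<dots> = zeta m ^ nat (k mod int m)"
    using assms by (simp add: zeta_power_self power_int_def)
  finally show ?thesis ..
qed

lemma cyclotomic_ring_simps [simp]:
  "x \<otimes>\<^bsub>cyclotomic_ring N\<^esub> y = x * y" "x \<oplus>\<^bsub>cyclotomic_ring N\<^esub> y = x + y"
  "\<one>\<^bsub>cyclotomic_ring N\<^esub> = 1" "\<zero>\<^bsub>cyclotomic_ring N\<^esub> = 0"
  by (simp_all add: cyclotomic_ring_def ring_of_type_algebra_def)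

lemma zeta_in_cyclotomic_ring: "zeta N \<in> carrier (cyclotomic_ring N)"
  by (simp add: cyclotomic_ring_def generate_ring.incl)

lemma cyclotomic_ring_a_inv:
  assumes "x \<in> carrier (cyclotomic_ring N)"
  shows "\<ominus>\<^bsub>cyclotomic_ring N\<^esub> x = - x"
proof -
  interpret cring "cyclotomic_ring N" by (rule cring_cyclotomic_ring)
  have "x + \<ominus>\<^bsub>cyclotomic_ring N\<^esub> x = 0"
    using r_neg[OF assms] by simp
  then show ?thesis by (simp add: eq_neg_iff_add_eq_0 add.commute)
qed

lemma cgenideal_cyclotomic_ring:
  "PIdl\<^bsub>cyclotomic_ring N\<^esub> a = (*) a ` carrier (cyclotomic_ring N)"
  by (auto simp: cgenideal_def image_iff mult.commute)

lemma cyclotomic_ring_power_closed: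
  assumes "x \<in> carrier (cyclotomic_ring N)"
  shows "x ^ k \<in> carrier (cyclotomic_ring N)"
proof -
  interpret cring "cyclotomic_ring N" by (rule cring_cyclotomic_ring)
  show ?thesis
    using one_closed assms m_closed by (induction k) simp_all
qed

text \<open>The operations are those of the complex numbers, but \<open>finsum\<close> and
  \<open>finprod\<close> are identified with ordinary sums and products only for values in the
  carrier; hence the membership checks.\<close>

lemma ring_det_cyclotomic_ring:
  assumes "finite S" and A: "\<And>i j. i \<in> S \<Longrightarrow> j \<in> S \<Longrightarrow> A i j \<in> carrier (cyclotomic_ring N)"
  shows "ring_det (cyclotomic_ring N) S A = leibniz_det S A"
proof -
  let ?R = "cyclotomic_ring N"
  interpret cring ?R by (rule cring_cyclotomic_ring)
  have fp: "finprod ?R f B = prod f B" if "finite B" "f \<in> B \<rightarrow> carrier ?R" for f and B :: "'b set"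
    using that by (induction B rule: finite_induct) (auto simp: finprod_insert Pi_iff)
  have fs: "finsum ?R f B = sum f B" if "finite B" "f \<in> B \<rightarrow> carrier ?R" for f and B :: "('b \<Rightarrow> 'b) set"
    using that by (induction B rule: finite_induct) (auto simp: finsum_insert Pi_iff)
  have Ap: "(\<lambda>i. A i (p i)) \<in> S \<rightarrow> carrier ?R" if "p permutes S" for p
    using that A by (auto simp: permutes_in_image)
  have pc: "(\<Prod>i\<in>S. A i (p i)) \<in> carrier ?R" if "p permutes S" for p
    using finprod_closed[OF Ap[OF that]] fp[OF assms(1) Ap[OF that]] by simp
  have "ring_det ?R S A = finsum ?R (\<lambda>p. of_int (sign p) * (\<Prod>i\<in>S. A i (p i))) {p. p permutes S}"
    unfolding ring_det_def
  proof (rule finsum_cong')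
    show "(\<lambda>p. of_int (sign p) * (\<Prod>i\<in>S. A i (p i))) \<in> {p. p permutes S} \<rightarrow> carrier ?R"
      using pc a_inv_closed[OF pc] by (auto simp: sign_def cyclotomic_ring_a_inv[OF pc])
  qed (auto simp: fp[OF assms(1) Ap] sign_def cyclotomic_ring_a_inv[OF pc])
  also have "\<dots> = leibniz_det S A"
    unfolding leibniz_det_def
  proof (rule fs)
    show "(\<lambda>p. of_int (sign p) * (\<Prod>i\<in>S. A i (p i))) \<in> {p. p permutes S} \<rightarrow> carrier ?R"
      using pc a_inv_closed[OF pc] by (auto simp: sign_def cyclotomic_ring_a_inv[OF pc])
  qed (simp add: finite_permutations assms(1))
  finally show ?thesis .
qed

section \<open>Determinants, ring homomorphisms and the characteristic\<close>

lemma (in cring) ring_det_closed: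
  assumes "\<And>i j. i \<in> S \<Longrightarrow> j \<in> S \<Longrightarrow> A i j \<in> carrier R"
  shows "ring_det R S A \<in> carrier R"
proof -
  have "(\<Otimes>i\<in>S. A i (p i)) \<in> carrier R" if "p permutes S" for p
    using that assms by (intro finprod_closed) (auto simp: permutes_in_image)
  then show ?thesis unfolding ring_det_def by (intro finsum_closed) auto
qed

text \<open>The determinant is built from sums, products and negation only. For the quotient map
  this turns the condition on \<open>f(F)\<close> into minors of \<open>F\<close> lying outside the
  ideal.\<close>

lemma (in ring_hom_cring) hom_ring_det:
  assumes "finite T" and A: "\<And>i j. i \<in> T \<Longrightarrow> j \<in> T \<Longrightarrow> A i j \<in> carrier R"
  shows "h (ring_det R T A) = ring_det S T (\<lambda>i j. h (A i j))"
proof -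
  have Ap: "(\<lambda>i. A i (p i)) \<in> T \<rightarrow> carrier R" if "p permutes T" for p
    using that A by (auto simp: permutes_in_image)
  note [simp] = R.finprod_closed[OF Ap]
  have "h (ring_det R T A) = (\<Oplus>\<^bsub>S\<^esub>p\<in>{p. p permutes T}.
      (h \<circ> (\<lambda>p. if evenperm p then \<Otimes>i\<in>T. A i (p i) else \<ominus> (\<Otimes>i\<in>T. A i (p i)))) p)"
    unfolding ring_det_def by (rule hom_finsum) auto
  also have "\<dots> = ring_det S T (\<lambda>i j. h (A i j))"
    unfolding ring_det_def
  proof (rule S.finsum_cong')
    have hp: "(\<Otimes>\<^bsub>S\<^esub>i\<in>T. h (A i (p i))) \<in> carrier S" if "p permutes T" for p
      using Ap[OF that] by (intro S.finprod_closed) auto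
    then show "(\<lambda>p. if evenperm p then \<Otimes>\<^bsub>S\<^esub>i\<in>T. h (A i (p i))
        else \<ominus>\<^bsub>S\<^esub> (\<Otimes>\<^bsub>S\<^esub>i\<in>T. h (A i (p i)))) \<in> {p. p permutes T} \<rightarrow> carrier S"
      by auto
  qed (auto simp: hom_finprod[OF Ap] o_def)
  finally show ?thesis .
qed

lemma (in ring_hom_cring) hom_add_pow_nat:
  assumes "x \<in> carrier R"
  shows "h ([(k::nat)] \<cdot> x) = [k] \<cdot>\<^bsub>S\<^esub> h x"
  using assms by (induction k) simp_all

lemma FactRing_zero: "\<zero>\<^bsub>R Quot I\<^esub> = I"
  by (simp add: FactRing_def)

lemma ring_characteristic_le:
  assumes "0 < k" and "[k] \<cdot>\<^bsub>R\<^esub> \<one>\<^bsub>R\<^esub> = \<zero>\<^bsub>R\<^esub>"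
  shows "ring_characteristic R \<noteq> 0 \<and> ring_characteristic R \<le> k"
proof -
  let ?P = "\<lambda>k::nat. k > 0 \<and> [k] \<cdot>\<^bsub>R\<^esub> \<one>\<^bsub>R\<^esub> = \<zero>\<^bsub>R\<^esub>"
  have "?P k" using assms by simp
  then have "\<exists>k. ?P k" by (rule exI)
  then have "ring_characteristic R = (LEAST k. ?P k)"
    unfolding ring_characteristic_def by (rule if_P)
  moreover have "?P (LEAST k. ?P k)" using \<open>?P k\<close> by (rule LeastI)
  moreover have "(LEAST k. ?P k) \<le> k" using \<open>?P k\<close> by (rule Least_le)
  ultimately show ?thesis by simp
qed

section \<open>Localisation of the cyclotomic ring and conclusion\<close>

theorem theorem1:
  fixes m n :: nat and G :: "'g set" and F :: "'g \<Rightarrow> 'g \<Rightarrow> complex"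
  defines "R \<equiv> cyclotomic_ring (m * n)"
  defines "I \<equiv> PIdl\<^bsub>R\<^esub> (1 - zeta n)"
  assumes "m > 0" and "n > 0" and "finite G"
    and "\<And>i j. i \<in> G \<Longrightarrow> j \<in> G \<Longrightarrow> \<exists>k::int. F i j = zeta m powi k"
    and "primeideal I R"
    and "ring_characteristic (R Quot I) = 0 \<or> ring_characteristic (R Quot I) \<ge> n"
    and "principally_nonsingular (R Quot I) G (\<lambda>i j. I +>\<^bsub>R\<^esub> F i j)"
  shows "principally_nonsingular complex_ring (G \<times> {0..<n}) (kronecker F (fourier_matrix n))"
proof -
  interpret I: primeideal I R by fact
  interpret h: ring_hom_cring R "R Quot I" "(+>\<^bsub>R\<^esub>) I" by (rule I.rcos_ring_hom_cring)
  let ?\<pi> = "1 - zeta n" and ?C = "carrier R"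
  have ops: "x \<otimes>\<^bsub>R\<^esub> y = x * y" "x \<oplus>\<^bsub>R\<^esub> y = x + y" "\<one>\<^bsub>R\<^esub> = 1" "\<zero>\<^bsub>R\<^esub> = 0" for x y
    by (simp_all add: R_def)
  have a_inv: "\<ominus>\<^bsub>R\<^esub> x = - x" if "x \<in> ?C" for x
    using that unfolding R_def by (rule cyclotomic_ring_a_inv)
  have one: "1 \<in> ?C" using I.one_closed by (simp add: ops)
  have add: "x + y \<in> ?C" if "x \<in> ?C" "y \<in> ?C" for x y using I.a_closed[OF that] by (simp add: ops)
  have mult: "x * y \<in> ?C" if "x \<in> ?C" "y \<in> ?C" for x y using I.m_closed[OF that] by (simp add: ops)
  have uminus: "- x \<in> ?C" if "x \<in> ?C" for x using I.a_inv_closed[OF that] by (simp add: a_inv[OF that])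
  have power: "zeta (m * n) ^ k \<in> ?C" for k
    unfolding R_def by (intro cyclotomic_ring_power_closed zeta_in_cyclotomic_ring)
  \<comment> \<open>Here \<open>zeta n\<close> is the \<open>m\<close>-th power of the generator
    \<open>zeta (m * n)\<close>.\<close>
  have pi: "?\<pi> \<in> ?C"
    using add[OF one uminus[OF power[of m]]] assms(3,4) by (simp add: zeta_mult_power)
  have F: "F i j \<in> ?C" if ij: "i \<in> G" "j \<in> G" for i j
  proof -
    obtain k where "F i j = zeta m powi k" using assms(6)[OF ij] by blast
    then obtain l where "F i j = zeta m ^ l" using zeta_power_int_eq_power[OF assms(3)] by metis
    then have "F i j = zeta (m * n) ^ (n * l)"
      using zeta_mult_power[OF assms(3,4)] by (simp add: power_mult)
    then show ?thesis using power by simp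
  qed
  have I_eq: "I = (*) ?\<pi> ` ?C"
    unfolding I_def R_def by (rule cgenideal_cyclotomic_ring)
  \<comment> \<open>The zero of the quotient is the coset \<open>I\<close> itself.\<close>
  have coset: "x \<notin> I" if "I +>\<^bsub>R\<^esub> x \<noteq> \<zero>\<^bsub>R Quot I\<^esub>" for x
    using that I.a_rcos_const[of x] unfolding FactRing_zero by blast
  have minors: "leibniz_det T F \<in> ?C - I" if T: "T \<subseteq> G" for T
  proof -
    have fin: "finite T" using T assms(5) by (rule finite_subset)
    have FT: "F i j \<in> ?C" if "i \<in> T" "j \<in> T" for i j using that T F by blast
    have "ring_det (R Quot I) T (\<lambda>i j. I +>\<^bsub>R\<^esub> F i j) \<noteq> \<zero>\<^bsub>R Quot I\<^esub>"
      using assms(9) T by (simp add: principally_nonsingular_def)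
    then have "I +>\<^bsub>R\<^esub> ring_det R T F \<noteq> \<zero>\<^bsub>R Quot I\<^esub>"
      using h.hom_ring_det[OF fin FT] by simp
    moreover have "ring_det R T F = leibniz_det T F"
      using fin FT unfolding R_def by (rule ring_det_cyclotomic_ring)
    moreover have "ring_det R T F \<in> ?C" using FT by (rule I.ring_det_closed)
    ultimately show ?thesis using coset by simp
  qed
  have one_notin: "1 \<notin> I" using I.I_notcarr I.one_imp_carrier unfolding ops by blast
  \<comment> \<open>A natural number \<open>k\<close> in \<open>I\<close> with
    \<open>0 < k < n\<close> would force a positive characteristic of at most
    \<open>k\<close>.\<close>
  have nat: "of_nat k \<notin> I" if k: "0 < k" "k < n" for k
  proof -
    have "[k] \<cdot>\<^bsub>R\<^esub> \<one>\<^bsub>R\<^esub> = of_nat k" for k :: nat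
      by (induction k) (simp_all add: ops)
    then have "I +>\<^bsub>R\<^esub> of_nat k = [k] \<cdot>\<^bsub>R Quot I\<^esub> \<one>\<^bsub>R Quot I\<^esub>"
      using h.hom_add_pow_nat[OF I.one_closed, of k] by simp
    also have "\<dots> \<noteq> \<zero>\<^bsub>R Quot I\<^esub>"
      using ring_characteristic_le[OF k(1), of "R Quot I"] assms(8) k(2) by auto
    finally show ?thesis by (rule coset)
  qed
  have prime: "x \<in> I \<or> y \<in> I" if "x \<in> ?C" "y \<in> ?C" "x * y \<in> I" for x y
    using I.I_prime[of x y] that by (simp add: ops)
  define L where "L = {r / s | r s. r \<in> ?C \<and> s \<in> ?C - I}"
  \<comment> \<open>The condition leaves room for \<open>n = 1\<close>, where the ideal is
    zero.\<close>
  have "?\<pi> \<noteq> 0" if "n > 1" using zeta_neq_1[OF that] by simp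
  note loc = localization_prime_element[of ?C ?\<pi> n, folded I_eq, folded L_def,
      OF one add uminus mult pi this one_notin prime nat]
  interpret L: prime_element L ?\<pi> n by (rule loc(1))
  have "ring_det complex_ring S (kronecker F (fourier_matrix n)) \<noteq> 0" if S: "S \<subseteq> G \<times> {0..<n}" for S
  proof -
    have fin: "finite S" using S assms(5) by (auto intro: finite_subset)
    have "leibniz_det S (\<lambda>p q. F (fst p) (fst q) * (1 - ?\<pi>) ^ (snd p * snd q)) \<noteq> 0"
    proof (rule L.kronecker_minor_nonzero[OF assms(5) _ _ S])
      show "F g h \<in> L" if "g \<in> G" "h \<in> G" for g h using F[OF that] loc(2) by blast
      show "leibniz_det T F \<notin> L.P" if "T \<subseteq> G" for T
        using loc(3) minors[OF that] by blast
    qed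
    \<comment> \<open>Since \<open>1 - (1 - zeta n) = zeta n\<close>, these are the entries of the
      Kronecker product.\<close>
    then show ?thesis
      by (simp add: ring_det_complex[OF fin] leibniz_det_def kronecker_def fourier_matrix_def)
  qed
  then show ?thesis
    by (simp add: principally_nonsingular_def ring_of_type_algebra_def)
qed

end
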